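(* Let $(M,\varphi_\alpha,\eta^\alpha,\xi_\alpha,g)$, $\alpha=1,2,3$, be a $3$-Sasakian manifold with HyperKahler contact distribution $\mathbf H$, let $\alpha\in\{1,2,3\}$ and $k\in\mathbb R$. For a unit vector $X\in\mathbf H$, the $\varphi_\alpha$-holomorphic sectional curvature of $\mathbf H$ satisfies $\bar H_\alpha(X)=k$ if and only if the $\varphi_\alpha$-sectional curvature of $M$, i.e. the sectional curvature (of the Levi-Civita connection) of the $\varphi_\alpha$-plane spanned by $X$ and $\varphi_\alpha X$, satisfies $K(X,\varphi_\alpha X)=k-3$.
   Context: A Sasakian structure on a Riemannian manifold $(M,g)$ consists of a $(1,1)$-tensor $\varphi$, a vector field $\xi$ and a $1$-form $\eta$ with $\varphi^2=-I+\eta\otimes\xi$, $\eta(\xi)=1$, $\eta(X)=g(\xi,X)$, $g(\varphi X,\varphi Y)=g(X,Y)-\eta(X)\eta(Y)$ and $(\nabla_X\varphi)Y=g(X,Y)\xi-\eta(Y)X$, where $\nabla$ is the Levi-Civita connection of $g$. A $3$-Sasakian manifold is a Riemannian manifold $(M^{4n+3},g)$ with three Sasakian structures $(\varphi_\alpha,\eta^\alpha,\xi_\alpha,g)$, $\alpha=1,2,3$, such that for all even permutations $(\beta,\gamma,\theta)$ of $(1,2,3)$: $\varphi_\theta=\varphi_\beta\varphi_\gamma-\eta^\gamma\otimes\xi_\beta=-\varphi_\gamma\varphi_\beta+\eta^\beta\otimes\xi_\gamma$, $\xi_\theta=\varphi_\beta\xi_\gamma=-\varphi_\gamma\xi_\beta$,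 $\eta^\theta=\eta^\beta\circ\varphi_\gamma=-\eta^\gamma\circ\varphi_\beta$. The HyperKahler contact distribution is $\mathbf H=\bigcap_{\alpha}\ker\eta^\alpha$ with the restrictions of $g$ and $\varphi_\alpha$. Put $\Omega^\alpha(X,Y)=g(X,\varphi_\alpha Y)$ and define the linear connection $$\bar{\nabla}_XY=\nabla_XY-\sum_{\alpha}\eta^{\alpha}(X)\nabla_Y\xi_{\alpha}-\sum_{\alpha}\eta^{\alpha}(Y)\nabla_X\xi_{\alpha}+\sum_{\alpha}\Omega^{\alpha}(X,Y)\xi_{\alpha}.$$ Curvatures: $R(X,Y)Z=\nabla_X\nabla_YZ-\nabla_Y\nabla_XZ-\nabla_{[X,Y]}Z$, and $\bar R$ is given by the same formula with $\bar\nabla$. Further $R(X,Y,Z,W)=g(R(X,Y)W,Z)$ and $\bar R(X,Y,Z,W)=g(\bar R(X,Y)W,Z)$. The sectional curvature is $K(X,Y)=\dfrac{R(X,Y,X,Y)}{g(X,X)g(Y,Y)-g(X,Y)^2}$, and for unit $X\in\mathbf H$, $\bar H_\alpha(X)=\bar R(X,\varphi_\alpha X,X,\varphi_\alpha X)$. *)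

theory Defs
  imports "HOL-Analysis.Analysis" "HOL-Library.Function_Algebras"
begin

section \<open>Smooth manifolds\<close>

text \<open>On an open subset of a Euclidean space this is the usual class \<open>C\<^sup>k\<close>: all iterated
  directional derivatives up to order \<open>k\<close> exist and are continuous.\<close>

primrec Ck_on :: "nat \<Rightarrow> 'a::euclidean_space set \<Rightarrow> ('a \<Rightarrow> 'b::real_normed_vector) \<Rightarrow> bool" where
  "Ck_on 0 S f \<longleftrightarrow> continuous_on S f"
| "Ck_on (Suc k) S f \<longleftrightarrow>
     (\<forall>x\<in>S. f differentiable (at x)) \<and> (\<forall>v. Ck_on k S (\<lambda>x. frechet_derivative f (at x) v))"

definition smooth_on :: "'a::euclidean_space set \<Rightarrow> ('a \<Rightarrow> 'b::real_normed_vector) \<Rightarrow> bool" where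
  "smooth_on S f \<longleftrightarrow> (\<forall>k. Ck_on k S f)"

text \<open>A chart is a pair \<open>(U, \<psi>)\<close> of its domain and its coordinate map; only the values of
  \<open>\<psi>\<close> on \<open>U\<close> matter. The manifold is the whole type \<open>'m\<close>, its dimension is that of \<open>'e\<close>.\<close>

type_synonym ('m, 'e) chart = "'m set \<times> ('m \<Rightarrow> 'e)"

definition smooth_manifold ::
  "('m::{t2_space, second_countable_topology}, 'e::euclidean_space) chart set \<Rightarrow> bool" where
  "smooth_manifold A \<longleftrightarrow>
     (\<forall>(U, \<psi>)\<in>A. open U \<and> open (\<psi> ` U) \<and> homeomorphism U (\<psi> ` U) \<psi> (inv_into U \<psi>)) \<and>
     (\<Union>(U, \<psi>)\<in>A. U) = UNIV \<and>
     (\<forall>(U, \<psi>)\<in>A. \<forall>(V, \<psi>')\<in>A. smooth_on (\<psi> ` (U \<inter> V)) (\<psi>' \<circ> inv_into U \<psi>))"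

definition smooth_functions :: "('m, 'e::euclidean_space) chart set \<Rightarrow> ('m \<Rightarrow> real) set" where
  "smooth_functions A = {f. \<forall>(U, \<psi>)\<in>A. smooth_on (\<psi> ` U) (f \<circ> inv_into U \<psi>)}"

text \<open>A tangent vector is identified with the derivative operator on smooth functions that it
  induces; it is set to \<open>0\<close> on functions that are not smooth. Sums, differences and \<open>0\<close> of
  tangent vectors and of vector fields are the pointwise ones of \<open>Function_Algebras\<close>.\<close>

type_synonym 'm tangent = "('m \<Rightarrow> real) \<Rightarrow> real"
type_synonym 'm vfield = "'m \<Rightarrow> 'm tangent"

definition chart_vector ::
  "('m, 'e::euclidean_space) chart set \<Rightarrow> ('m, 'e) chart \<Rightarrow> 'm \<Rightarrow> 'e \<Rightarrow> 'm tangent" where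
  "chart_vector A c p u = (\<lambda>f. if f \<in> smooth_functions A
     then frechet_derivative (f \<circ> inv_into (fst c) (snd c)) (at (snd c p)) u else 0)"

definition tangent_space :: "('m, 'e::euclidean_space) chart set \<Rightarrow> 'm \<Rightarrow> 'm tangent set" where
  "tangent_space A p = {chart_vector A c p u | c u. c \<in> A \<and> p \<in> fst c}"

definition tscale :: "real \<Rightarrow> 'm tangent \<Rightarrow> 'm tangent" where
  "tscale c x = (\<lambda>f. c * x f)"

definition fscale :: "('m \<Rightarrow> real) \<Rightarrow> 'm vfield \<Rightarrow> 'm vfield" where
  "fscale a X = (\<lambda>p. tscale (a p) (X p))"

definition act :: "'m vfield \<Rightarrow> ('m \<Rightarrow> real) \<Rightarrow> 'm \<Rightarrow> real" where
  "act X f = (\<lambda>p. X p f)"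

definition vector_fields :: "('m, 'e::euclidean_space) chart set \<Rightarrow> 'm vfield set" where
  "vector_fields A = {X. (\<forall>p. X p \<in> tangent_space A p) \<and>
     (\<forall>f\<in>smooth_functions A. act X f \<in> smooth_functions A)}"

definition bracket :: "'m vfield \<Rightarrow> 'm vfield \<Rightarrow> 'm vfield" where
  "bracket X Y = (\<lambda>p f. X p (act Y f) - Y p (act X f))"

section \<open>Tensor fields, metrics and connections\<close>

text \<open>Applies a 1-form or a (1,1)-tensor field to a vector field.\<close>

definition app :: "('m \<Rightarrow> 'm tangent \<Rightarrow> 'b) \<Rightarrow> 'm vfield \<Rightarrow> 'm \<Rightarrow> 'b" where
  "app T X = (\<lambda>p. T p (X p))"

definition app2 :: "('m \<Rightarrow> 'm tangent \<Rightarrow> 'm tangent \<Rightarrow> real) \<Rightarrow> 'm vfield \<Rightarrow> 'm vfield \<Rightarrow> 'm \<Rightarrow> real" where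
  "app2 T X Y = (\<lambda>p. T p (X p) (Y p))"

definition one_form ::
  "('m, 'e::euclidean_space) chart set \<Rightarrow> ('m \<Rightarrow> 'm tangent \<Rightarrow> real) \<Rightarrow> bool" where
  "one_form A \<eta> \<longleftrightarrow>
     (\<forall>p. \<forall>x\<in>tangent_space A p. \<forall>y\<in>tangent_space A p. \<eta> p (x + y) = \<eta> p x + \<eta> p y) \<and>
     (\<forall>p. \<forall>x\<in>tangent_space A p. \<forall>c. \<eta> p (tscale c x) = c * \<eta> p x) \<and>
     (\<forall>X\<in>vector_fields A. app \<eta> X \<in> smooth_functions A)"

definition endo_tensor ::
  "('m, 'e::euclidean_space) chart set \<Rightarrow> ('m \<Rightarrow> 'm tangent \<Rightarrow> 'm tangent) \<Rightarrow> bool" where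
  "endo_tensor A \<phi> \<longleftrightarrow>
     (\<forall>p. \<forall>x\<in>tangent_space A p. \<phi> p x \<in> tangent_space A p) \<and>
     (\<forall>p. \<forall>x\<in>tangent_space A p. \<forall>y\<in>tangent_space A p. \<phi> p (x + y) = \<phi> p x + \<phi> p y) \<and>
     (\<forall>p. \<forall>x\<in>tangent_space A p. \<forall>c. \<phi> p (tscale c x) = tscale c (\<phi> p x)) \<and>
     (\<forall>X\<in>vector_fields A. app \<phi> X \<in> vector_fields A)"

definition riemannian_metric ::
  "('m, 'e::euclidean_space) chart set \<Rightarrow> ('m \<Rightarrow> 'm tangent \<Rightarrow> 'm tangent \<Rightarrow> real) \<Rightarrow> bool" where
  "riemannian_metric A g \<longleftrightarrow>
     (\<forall>p. \<forall>x\<in>tangent_space A p. \<forall>y\<in>tangent_space A p. \<forall>z\<in>tangent_space A p.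
        g p (x + y) z = g p x z + g p y z) \<and>
     (\<forall>p. \<forall>x\<in>tangent_space A p. \<forall>y\<in>tangent_space A p. \<forall>c. g p (tscale c x) y = c * g p x y) \<and>
     (\<forall>p. \<forall>x\<in>tangent_space A p. \<forall>y\<in>tangent_space A p. g p x y = g p y x) \<and>
     (\<forall>p. \<forall>x\<in>tangent_space A p. x \<noteq> 0 \<longrightarrow> g p x x > 0) \<and>
     (\<forall>X\<in>vector_fields A. \<forall>Y\<in>vector_fields A. app2 g X Y \<in> smooth_functions A)"

type_synonym 'm connection = "'m vfield \<Rightarrow> 'm vfield \<Rightarrow> 'm vfield"

definition linear_connection :: "('m, 'e::euclidean_space) chart set \<Rightarrow> 'm connection \<Rightarrow> bool" where
  "linear_connection A D \<longleftrightarrow>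
     (\<forall>X\<in>vector_fields A. \<forall>Y\<in>vector_fields A. D X Y \<in> vector_fields A) \<and>
     (\<forall>X\<in>vector_fields A. \<forall>Y\<in>vector_fields A. \<forall>Z\<in>vector_fields A.
        D (X + Y) Z = D X Z + D Y Z \<and> D X (Y + Z) = D X Y + D X Z) \<and>
     (\<forall>X\<in>vector_fields A. \<forall>Y\<in>vector_fields A. \<forall>f\<in>smooth_functions A.
        D (fscale f X) Y = fscale f (D X Y) \<and>
        D X (fscale f Y) = fscale (act X f) Y + fscale f (D X Y))"

definition levi_civita ::
  "('m, 'e::euclidean_space) chart set \<Rightarrow> ('m \<Rightarrow> 'm tangent \<Rightarrow> 'm tangent \<Rightarrow> real) \<Rightarrow>
   'm connection \<Rightarrow> bool" where
  "levi_civita A g D \<longleftrightarrow> linear_connection A D \<and>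
     (\<forall>X\<in>vector_fields A. \<forall>Y\<in>vector_fields A. D X Y - D Y X = bracket X Y) \<and>
     (\<forall>X\<in>vector_fields A. \<forall>Y\<in>vector_fields A. \<forall>Z\<in>vector_fields A.
        act X (app2 g Y Z) = app2 g (D X Y) Z + app2 g Y (D X Z))"

definition curvature :: "'m connection \<Rightarrow> 'm vfield \<Rightarrow> 'm vfield \<Rightarrow> 'm vfield \<Rightarrow> 'm vfield" where
  "curvature D X Y Z = D X (D Y Z) - D Y (D X Z) - D (bracket X Y) Z"

text \<open>The curvature of a linear connection is a tensor, so its value on tangent vectors at
  \<open>p\<close> is computed by extending them to vector fields; the choice of extensions is immaterial.\<close>

definition extension :: "('m, 'e::euclidean_space) chart set \<Rightarrow> 'm \<Rightarrow> 'm tangent \<Rightarrow> 'm vfield" where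
  "extension A p x = (SOME X. X \<in> vector_fields A \<and> X p = x)"

text \<open>\<open>R(x, y, z, w) = g(R(x, y)w, z)\<close>, with \<open>z\<close> and \<open>w\<close> in this order.\<close>

definition curvature4 ::
  "('m, 'e::euclidean_space) chart set \<Rightarrow> ('m \<Rightarrow> 'm tangent \<Rightarrow> 'm tangent \<Rightarrow> real) \<Rightarrow>
   'm connection \<Rightarrow> 'm \<Rightarrow> 'm tangent \<Rightarrow> 'm tangent \<Rightarrow> 'm tangent \<Rightarrow> 'm tangent \<Rightarrow> real" where
  "curvature4 A g D p x y z w =
     g p (curvature D (extension A p x) (extension A p y) (extension A p w) p) z"

definition sectional_curvature ::
  "('m, 'e::euclidean_space) chart set \<Rightarrow> ('m \<Rightarrow> 'm tangent \<Rightarrow> 'm tangent \<Rightarrow> real) \<Rightarrow>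
   'm connection \<Rightarrow> 'm \<Rightarrow> 'm tangent \<Rightarrow> 'm tangent \<Rightarrow> real" where
  "sectional_curvature A g D p x y =
     curvature4 A g D p x y x y / (g p x x * g p y y - (g p x y)\<^sup>2)"

section \<open>3-Sasakian manifolds\<close>

text \<open>The argument \<open>D\<close> stands for the Levi-Civita connection of \<open>g\<close>.\<close>

definition sasakian ::
  "('m, 'e::euclidean_space) chart set \<Rightarrow> ('m \<Rightarrow> 'm tangent \<Rightarrow> 'm tangent \<Rightarrow> real) \<Rightarrow>
   'm connection \<Rightarrow> ('m \<Rightarrow> 'm tangent \<Rightarrow> 'm tangent) \<Rightarrow> ('m \<Rightarrow> 'm tangent \<Rightarrow> real) \<Rightarrow>
   'm vfield \<Rightarrow> bool" where
  "sasakian A g D \<phi> \<eta> \<xi> \<longleftrightarrow>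
     endo_tensor A \<phi> \<and> one_form A \<eta> \<and> \<xi> \<in> vector_fields A \<and>
     (\<forall>p. \<forall>x\<in>tangent_space A p. \<phi> p (\<phi> p x) = - x + tscale (\<eta> p x) (\<xi> p)) \<and>
     (\<forall>p. \<eta> p (\<xi> p) = 1) \<and>
     (\<forall>p. \<forall>x\<in>tangent_space A p. \<eta> p x = g p (\<xi> p) x) \<and>
     (\<forall>p. \<forall>x\<in>tangent_space A p. \<forall>y\<in>tangent_space A p.
        g p (\<phi> p x) (\<phi> p y) = g p x y - \<eta> p x * \<eta> p y) \<and>
     (\<forall>X\<in>vector_fields A. \<forall>Y\<in>vector_fields A.
        D X (app \<phi> Y) - app \<phi> (D X Y) = fscale (app2 g X Y) \<xi> - fscale (app \<eta> Y) X)"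

definition three_sasakian ::
  "nat \<Rightarrow> ('m::{t2_space, second_countable_topology}, 'e::euclidean_space) chart set \<Rightarrow>
   ('m \<Rightarrow> 'm tangent \<Rightarrow> 'm tangent \<Rightarrow> real) \<Rightarrow> 'm connection \<Rightarrow>
   (nat \<Rightarrow> 'm \<Rightarrow> 'm tangent \<Rightarrow> 'm tangent) \<Rightarrow> (nat \<Rightarrow> 'm \<Rightarrow> 'm tangent \<Rightarrow> real) \<Rightarrow>
   (nat \<Rightarrow> 'm vfield) \<Rightarrow> bool" where
  "three_sasakian n A g D \<phi> \<eta> \<xi> \<longleftrightarrow>
     smooth_manifold A \<and> DIM('e) = 4 * n + 3 \<and> riemannian_metric A g \<and> levi_civita A g D \<and>
     (\<forall>\<alpha>\<in>{1, 2, 3}. sasakian A g D (\<phi> \<alpha>) (\<eta> \<alpha>) (\<xi> \<alpha>)) \<and>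
     (\<forall>(\<beta>, \<gamma>, \<theta>)\<in>{(1, 2, 3), (2, 3, 1), (3, 1, 2)}. \<forall>p.
        (\<forall>x\<in>tangent_space A p.
           \<phi> \<theta> p x = \<phi> \<beta> p (\<phi> \<gamma> p x) - tscale (\<eta> \<gamma> p x) (\<xi> \<beta> p) \<and>
           \<phi> \<theta> p x = - \<phi> \<gamma> p (\<phi> \<beta> p x) + tscale (\<eta> \<beta> p x) (\<xi> \<gamma> p) \<and>
           \<eta> \<theta> p x = \<eta> \<beta> p (\<phi> \<gamma> p x) \<and>
           \<eta> \<theta> p x = - \<eta> \<gamma> p (\<phi> \<beta> p x)) \<and>
        \<xi> \<theta> p = \<phi> \<beta> p (\<xi> \<gamma> p) \<and>
        \<xi> \<theta> p = - \<phi> \<gamma> p (\<xi> \<beta> p))"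

definition contact_distribution ::
  "('m, 'e::euclidean_space) chart set \<Rightarrow> (nat \<Rightarrow> 'm \<Rightarrow> 'm tangent \<Rightarrow> real) \<Rightarrow>
   'm \<Rightarrow> 'm tangent set" where
  "contact_distribution A \<eta> p = {x\<in>tangent_space A p. \<forall>\<alpha>\<in>{1, 2, 3}. \<eta> \<alpha> p x = 0}"

definition Omega ::
  "('m \<Rightarrow> 'm tangent \<Rightarrow> 'm tangent \<Rightarrow> real) \<Rightarrow> ('m \<Rightarrow> 'm tangent \<Rightarrow> 'm tangent) \<Rightarrow>
   'm \<Rightarrow> 'm tangent \<Rightarrow> 'm tangent \<Rightarrow> real" where
  "Omega g \<phi> p x y = g p x (\<phi> p y)"

definition bar_connection ::
  "('m \<Rightarrow> 'm tangent \<Rightarrow> 'm tangent \<Rightarrow> real) \<Rightarrow> 'm connection \<Rightarrow>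
   (nat \<Rightarrow> 'm \<Rightarrow> 'm tangent \<Rightarrow> 'm tangent) \<Rightarrow> (nat \<Rightarrow> 'm \<Rightarrow> 'm tangent \<Rightarrow> real) \<Rightarrow>
   (nat \<Rightarrow> 'm vfield) \<Rightarrow> 'm connection" where
  "bar_connection g D \<phi> \<eta> \<xi> X Y = D X Y
     - (\<Sum>\<alpha>\<in>{1, 2, 3}. fscale (app (\<eta> \<alpha>) X) (D Y (\<xi> \<alpha>)))
     - (\<Sum>\<alpha>\<in>{1, 2, 3}. fscale (app (\<eta> \<alpha>) Y) (D X (\<xi> \<alpha>)))
     + (\<Sum>\<alpha>\<in>{1, 2, 3}. fscale (app2 (Omega g (\<phi> \<alpha>)) X Y) (\<xi> \<alpha>))"

definition holomorphic_curvature_H ::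
  "('m, 'e::euclidean_space) chart set \<Rightarrow> ('m \<Rightarrow> 'm tangent \<Rightarrow> 'm tangent \<Rightarrow> real) \<Rightarrow>
   'm connection \<Rightarrow> (nat \<Rightarrow> 'm \<Rightarrow> 'm tangent \<Rightarrow> 'm tangent) \<Rightarrow>
   (nat \<Rightarrow> 'm \<Rightarrow> 'm tangent \<Rightarrow> real) \<Rightarrow> (nat \<Rightarrow> 'm vfield) \<Rightarrow> nat \<Rightarrow> 'm \<Rightarrow> 'm tangent \<Rightarrow> real" where
  "holomorphic_curvature_H A g D \<phi> \<eta> \<xi> \<alpha> p x =
     curvature4 A g (bar_connection g D \<phi> \<eta> \<xi>) p x (\<phi> \<alpha> p x) x (\<phi> \<alpha> p x)"

end

theory Submission
  imports Defs
begin

text \<open>The curvatures differ by an explicit constant: \<open>H\<^sub>\<alpha>(x) = K(x, \<phi>\<^sub>\<alpha> x) + 3\<close> for the curvature \<open>H\<^sub>\<alpha>\<close> of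
  the modified connection, which gives the equivalence for every \<open>k\<close>.

  A Sasakian structure satisfies \<open>\<nabla>\<^sub>X \<xi> = - \<phi> X\<close> (\<open>D_xi\<close>). The modified connection is therefore
  \<open>\<nabla>\<^sub>X Y\<close> plus, for each of the three structures, the tensor
  \<open>\<eta>(X) \<phi> Y + \<eta>(Y) \<phi> X + g(X, \<phi> Y) \<xi>\<close>. At a point where \<open>X\<close> and \<open>Y\<close> have horizontal values \<open>x\<close> and \<open>y\<close>, almost
  everything vanishes in the inner product with \<open>x\<close> of the curvature applied to \<open>X, Y, Y\<close>: what is left
  comes from differentiating \<open>\<eta>(Y)\<close>, which gives \<open>\<eta>(\<nabla>\<^sub>X Y) - g(\<phi> x, y)\<close>, from differentiating \<open>\<xi>\<close>,
  and from applying the added tensor twice.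
  The result is that the modified curvature exceeds the Riemannian one by \<open>3 \<Sum>\<^sub>\<beta> g(\<phi>\<^sub>\<beta> x, y)\<^sup>2\<close>
  (\<open>g_curvature_bar\<close>). For \<open>y = \<phi>\<^sub>\<alpha> x\<close> with \<open>x\<close> a unit vector, the quaternionic relations make
  \<open>\<phi>\<^sub>1 x, \<phi>\<^sub>2 x, \<phi>\<^sub>3 x\<close> orthonormal (\<open>phi_orthogonal\<close>), and the sum is \<open>1\<close>.

  Curvatures at a point are defined by extending tangent vectors to vector fields, which carries no
  information unless such extensions exist (\<open>extension\<close>). A chart provides a field with constant coordinates, and a
  smooth bump function extends it by zero. This needs the calculus of \<open>C\<^sup>k\<close> functions, in particular
  closure under composition, and the smoothness of \<open>exp (-1/t)\<close> cut off at \<open>0\<close>.\<close>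

section \<open>Functions of class \<open>C\<^sup>k\<close>\<close>

lemma Ck_on_cong:
  assumes "open S" "\<And>x. x \<in> S \<Longrightarrow> f x = g x"
  shows "Ck_on k S f = Ck_on k S g"
  using assms(2)
proof (induction k arbitrary: f g)
  case 0
  then show ?case by (auto intro: continuous_on_cong[THEN iffD1])
next
  case (Suc k)
  have der: "(f has_derivative F) (at x) \<longleftrightarrow> (g has_derivative F) (at x)" if "x \<in> S" for x F
    using has_derivative_transform_within_open[OF _ \<open>open S\<close> that] Suc.prems by metis
  have "frechet_derivative f (at x) = frechet_derivative g (at x)" if "x \<in> S" for x
    using der[OF that] by (simp add: frechet_derivative_def)
  with Suc.IH[of "\<lambda>x. frechet_derivative f (at x) v" "\<lambda>x. frechet_derivative g (at x) v" for v]
  show ?case using der by (simp add: differentiable_def)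
qed

text \<open>The recursion behind \<open>C\<^sup>k\<close> mentions the Frechet derivative as a chosen function; this rule
  accepts any explicit formula for the derivative instead.\<close>

lemma Ck_on_SucI:
  assumes "open S" "\<And>x. x \<in> S \<Longrightarrow> (f has_derivative F x) (at x)"
    and "\<And>v. Ck_on k S (\<lambda>x. F x v)"
  shows "Ck_on (Suc k) S f"
proof -
  have eq: "F x = frechet_derivative f (at x)" if "x \<in> S" for x
    using assms(2)[OF that] frechet_derivative_at by metis
  have "Ck_on k S (\<lambda>x. frechet_derivative f (at x) v)" for v
    by (rule iffD1[OF Ck_on_cong[OF assms(1)] assms(3)]) (simp add: eq)
  then show ?thesis
    using assms(2) by (auto simp: differentiable_def)
qed

lemma Ck_on_SucD:
  assumes "Ck_on (Suc k) S f"
  shows "x \<in> S \<Longrightarrow> (f has_derivative frechet_derivative f (at x)) (at x)"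
    and "Ck_on k S (\<lambda>x. frechet_derivative f (at x) v)"
  using assms by (auto simp: frechet_derivative_works)

lemma Ck_on_pred: "Ck_on (Suc k) S f \<Longrightarrow> Ck_on k S f"
proof (induction k arbitrary: f)
  case 0
  then show ?case
    by (auto intro!: continuous_at_imp_continuous_on differentiable_imp_continuous_within)
next
  case (Suc k)
  then show ?case by (metis Ck_on.simps(2))
qed

lemma Ck_on_subset: "Ck_on k S f \<Longrightarrow> T \<subseteq> S \<Longrightarrow> Ck_on k T f"
  by (induction k arbitrary: f) (auto intro: continuous_on_subset)

lemma Ck_on_Un: "open S \<Longrightarrow> open T \<Longrightarrow> Ck_on k S f \<Longrightarrow> Ck_on k T f \<Longrightarrow> Ck_on k (S \<union> T) f"
  by (induction k arbitrary: f) (auto intro: continuous_on_open_Un)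

lemma Ck_on_const: "open S \<Longrightarrow> Ck_on k S (\<lambda>x. c)"
  by (induction k arbitrary: c) (auto intro!: Ck_on_SucI[where F = "\<lambda>x v. 0"] simp del: Ck_on.simps(2))

lemma Ck_on_add:
  "open S \<Longrightarrow> Ck_on k S f \<Longrightarrow> Ck_on k S g \<Longrightarrow> Ck_on k S (\<lambda>x. f x + g x)"
proof (induction k arbitrary: f g)
  case (Suc k)
  show ?case
    using Suc.IH[OF Suc.prems(1) Ck_on_SucD(2)[OF Suc.prems(2)] Ck_on_SucD(2)[OF Suc.prems(3)]]
    by (intro Ck_on_SucI[OF Suc.prems(1)])
      (auto intro!: has_derivative_add Ck_on_SucD(1)[OF Suc.prems(2)] Ck_on_SucD(1)[OF Suc.prems(3)])
qed (simp add: continuous_on_add)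

lemma Ck_on_sum:
  assumes "open S"
  shows "finite I \<Longrightarrow> (\<And>i. i \<in> I \<Longrightarrow> Ck_on k S (f i)) \<Longrightarrow> Ck_on k S (\<lambda>x. \<Sum>i\<in>I. f i x)"
  by (induction rule: finite_induct) (simp_all add: Ck_on_const Ck_on_add assms)

lemma Ck_on_linear:
  assumes "bounded_linear L" "open S"
  shows "Ck_on k S f \<Longrightarrow> Ck_on k S (\<lambda>x. L (f x))"
proof (induction k arbitrary: f)
  case 0
  then show ?case using assms by (simp add: bounded_linear.continuous_on)
next
  case (Suc k)
  show ?case
    using Suc.IH[OF Ck_on_SucD(2)[OF Suc.prems]]
    by (intro Ck_on_SucI[OF assms(2)])
      (auto intro!: bounded_linear.has_derivative[OF assms(1)] Ck_on_SucD(1)[OF Suc.prems])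
qed

lemma Ck_on_mult:
  fixes f g :: "'a::euclidean_space \<Rightarrow> real"
  shows "open S \<Longrightarrow> Ck_on k S f \<Longrightarrow> Ck_on k S g \<Longrightarrow> Ck_on k S (\<lambda>x. f x * g x)"
proof (induction k arbitrary: f g)
  case (Suc k)
  show ?case
    by (rule Ck_on_SucI[OF Suc.prems(1)
          has_derivative_mult[OF Ck_on_SucD(1)[OF Suc.prems(2)] Ck_on_SucD(1)[OF Suc.prems(3)]]])
      (intro Ck_on_add Suc.IH Suc.prems(1) Ck_on_SucD(2)[OF Suc.prems(2)]
        Ck_on_SucD(2)[OF Suc.prems(3)] Ck_on_pred[OF Suc.prems(2)] Ck_on_pred[OF Suc.prems(3)]
        | assumption)+
qed (simp add: continuous_on_mult)

text \<open>The chain rule turns a directional derivative of \<open>g \<circ> f\<close> into a sum over a basis of products of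
  a component of the derivative of \<open>f\<close> with a partial derivative of \<open>g\<close> evaluated at \<open>f x\<close>. The
  latter is again a composition, with one order of differentiability less, so induction applies;
  it has to leave \<open>g\<close> free, since \<open>g\<close> is replaced by its partial derivatives.\<close>

lemma Ck_on_compose:
  fixes f :: "'a::euclidean_space \<Rightarrow> 'b::euclidean_space" and g :: "'b \<Rightarrow> real"
  assumes "open S" "f ` S \<subseteq> T"
  shows "Ck_on k S f \<Longrightarrow> Ck_on k T g \<Longrightarrow> Ck_on k S (\<lambda>x. g (f x))"
proof (induction k arbitrary: g)
  case 0
  then show ?case using assms(2) by (auto intro: continuous_on_compose2)
next
  case (Suc k)
  let ?f = "\<lambda>x. frechet_derivative f (at x)" and ?g = "\<lambda>y. frechet_derivative g (at y)"
  have g: "(g has_derivative ?g (f x)) (at (f x))" if "x \<in> S" for x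
    using Ck_on_SucD(1)[OF Suc.prems(2)] that assms(2) by auto
  have eq: "?g (f x) w = (\<Sum>b\<in>Basis. (w \<bullet> b) * ?g (f x) b)" if "x \<in> S" for x w
  proof -
    interpret bounded_linear "?g (f x)" using g[OF that] has_derivative_bounded_linear by blast
    have "?g (f x) w = ?g (f x) (\<Sum>b\<in>Basis. (w \<bullet> b) *\<^sub>R b)" by (simp add: euclidean_representation)
    then show ?thesis by (simp add: sum scaleR)
  qed
  show ?case
  proof (rule Ck_on_SucI[OF assms(1), where F = "\<lambda>x v. ?g (f x) (?f x v)"])
    show "((\<lambda>x. g (f x)) has_derivative (\<lambda>v. ?g (f x) (?f x v))) (at x)" if "x \<in> S" for x
      using diff_chain_at[OF Ck_on_SucD(1)[OF Suc.prems(1) that] g[OF that]] by (simp add: o_def)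
    fix v
    have "Ck_on k S (\<lambda>x. \<Sum>b\<in>Basis. (?f x v \<bullet> b) * ?g (f x) b)"
      by (intro Ck_on_sum Ck_on_mult assms(1) Suc.IH finite_Basis
          Ck_on_linear[OF bounded_linear_inner_left] Ck_on_SucD(2)[OF Suc.prems(1)]
          Ck_on_SucD(2)[OF Suc.prems(2)] Ck_on_pred[OF Suc.prems(1)])
    then show "Ck_on k S (\<lambda>x. ?g (f x) (?f x v))"
      by (rule Ck_on_cong[OF assms(1), THEN iffD1, rotated 1]) (rule eq[symmetric])
  qed
qed

lemma Ck_on_ident: "open S \<Longrightarrow> Ck_on k S (\<lambda>x. x)"
  by (cases k) (auto intro!: Ck_on_SucI[where F = "\<lambda>x v. v"] Ck_on_const simp del: Ck_on.simps(2))

section \<open>Bump functions\<close>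

text \<open>Only \<open>n = 0\<close>, the function \<open>exp (-1/t)\<close>, goes into a bump function. Its derivatives bring in powers of
  \<open>1/t\<close>, and the whole family is closed under differentiation up to linear combinations, so that
  smoothness can be proved for all \<open>n\<close> at once by induction on the order.\<close>

definition flat_power :: "nat \<Rightarrow> real \<Rightarrow> real" where
  "flat_power n t = (if t > 0 then inverse t ^ n * exp (- inverse t) else 0)"

lemma flat_power_tendsto_0: "(flat_power n \<longlongrightarrow> 0) (at 0)"
proof -
  have "((\<lambda>s::real. s ^ n / exp s) \<longlongrightarrow> 0) at_top" by (rule tendsto_power_div_exp_0)
  then have "((\<lambda>t::real. inverse t ^ n / exp (inverse t)) \<longlongrightarrow> 0) (at_right 0)"
    by (rule filterlim_compose[OF _ filterlim_inverse_at_top_right])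
  then have "(flat_power n \<longlongrightarrow> 0) (at_right 0)"
    by (rule tendsto_cong[THEN iffD1, rotated])
      (auto simp: eventually_at_filter flat_power_def exp_minus divide_inverse)
  moreover have "(flat_power n \<longlongrightarrow> 0) (at_left 0)"
    by (rule tendsto_cong[THEN iffD1, OF _ tendsto_const])
      (auto simp: eventually_at_filter flat_power_def)
  ultimately show ?thesis by (simp add: filterlim_split_at)
qed

lemma flat_power_has_derivative:
  "(flat_power n has_real_derivative flat_power (n + 2) t - real n * flat_power (n + 1) t) (at t)"
proof (cases t "0::real" rule: linorder_cases)
  case less
  have "((\<lambda>t. 0) has_real_derivative 0) (at t)" by simp
  then have "(flat_power n has_real_derivative 0) (at t)"
    by (rule has_field_derivative_transform_within_open[of _ _ _ "{..<0}"])
      (use less in \<open>auto simp: flat_power_def\<close>)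
  then show ?thesis using less by (simp add: flat_power_def)
next
  case equal
  \<comment> \<open>At \<open>0\<close> the difference quotient of one member of the family is the next member.\<close>
  have "((\<lambda>h. (flat_power n (0 + h) - flat_power n 0) / h) \<longlongrightarrow> 0) (at 0)"
    by (rule tendsto_cong[THEN iffD1, OF _ flat_power_tendsto_0[of "Suc n"]])
      (auto simp: eventually_at_filter flat_power_def divide_inverse)
  then show ?thesis using equal by (simp add: DERIV_def flat_power_def)
next
  case greater
  let ?s = "inverse t"
  have "((\<lambda>s. s ^ n * exp (- s)) has_real_derivative
      (real n * ?s ^ (n - 1) - ?s ^ n) * exp (- ?s)) (at ?s)"
    by (auto intro!: derivative_eq_intros simp: algebra_simps)
  from DERIV_chain2[OF this DERIV_inverse] greater
  have "((\<lambda>t. inverse t ^ n * exp (- inverse t)) has_real_derivative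
      (real n * ?s ^ (n - 1) - ?s ^ n) * exp (- ?s) * - (?s ^ Suc (Suc 0))) (at t)"
    by simp
  also have "(real n * ?s ^ (n - 1) - ?s ^ n) * exp (- ?s) * - (?s ^ Suc (Suc 0)) =
      flat_power (n + 2) t - real n * flat_power (n + 1) t"
    using greater by (cases n) (simp_all add: flat_power_def algebra_simps)
  finally have "((\<lambda>t. inverse t ^ n * exp (- inverse t)) has_real_derivative
      flat_power (n + 2) t - real n * flat_power (n + 1) t) (at t)" .
  then show ?thesis
    by (rule has_field_derivative_transform_within_open[of _ _ _ "{0<..}"])
      (use greater in \<open>auto simp: flat_power_def\<close>)
qed

lemma Ck_on_flat_power: "Ck_on k UNIV (flat_power n)"
proof (induction k arbitrary: n)
  case 0
  show ?case
    by (simp add: continuous_at_imp_continuous_on DERIV_isCont[OF flat_power_has_derivative])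
next
  case (Suc k)
  show ?case
  proof (rule Ck_on_SucI)
    fix v :: real
    show "Ck_on k UNIV (\<lambda>t. (flat_power (n + 2) t + (- real n) * flat_power (n + 1) t) * v)"
      by (intro Ck_on_mult Ck_on_add Ck_on_const Suc open_UNIV)
  qed (use flat_power_has_derivative[of n] in \<open>auto simp: has_field_derivative_def\<close>)
qed

lemma bump_function_exists:
  fixes a :: "'a::euclidean_space"
  assumes "r > 0"
  obtains h :: "'a \<Rightarrow> real" where "smooth_on UNIV h" "h a \<noteq> 0" "\<And>y. y \<notin> cball a r \<Longrightarrow> h y = 0"
proof
  let ?q = "\<lambda>y::'a. r\<^sup>2 + - ((y - a) \<bullet> (y - a))"
  let ?h = "\<lambda>y. flat_power 0 (?q y)"
  have lin: "Ck_on k UNIV (\<lambda>y::'a. (y - a) \<bullet> v)" for k v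
    using Ck_on_linear[OF bounded_linear_inner_left open_UNIV
      Ck_on_add[OF open_UNIV Ck_on_ident Ck_on_const[of _ _ "- a"]]] by simp
  have q: "Ck_on (Suc k) UNIV ?q" for k
  proof (rule Ck_on_SucI)
    show "(?q has_derivative (\<lambda>v. (y - a) \<bullet> v * - 2)) (at y)" for y
      by (auto intro!: derivative_eq_intros simp: inner_commute)
    show "Ck_on k UNIV (\<lambda>y::'a. (y - a) \<bullet> v * - 2)" for v
      by (intro Ck_on_mult Ck_on_const lin open_UNIV)
  qed auto
  show "smooth_on UNIV ?h"
    unfolding smooth_on_def
    by (intro allI Ck_on_compose[where f = ?q and g = "flat_power 0" and T = UNIV]
        Ck_on_pred[OF q] Ck_on_flat_power) auto
  show "?h a \<noteq> 0" using assms by (simp add: flat_power_def)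
  show "?h y = 0" if "y \<notin> cball a r" for y
  proof -
    have "r\<^sup>2 < (norm (y - a))\<^sup>2"
      using that assms by (auto simp: dist_norm norm_minus_commute intro: power_strict_mono)
    then show ?thesis by (simp add: flat_power_def power2_norm_eq_inner)
  qed
qed

section \<open>Calculus on a smooth manifold\<close>

lemma tscale_simps:
  "tscale c (x + y) = tscale c x + tscale c y" "tscale (c + d) x = tscale c x + tscale d x"
  "tscale c (- x) = - tscale c x" "tscale c (x - y) = tscale c x - tscale c y"
  "tscale c (tscale d x) = tscale (c * d) x" "tscale 1 x = x" "tscale 0 x = 0" "tscale c 0 = 0"
  "tscale (- c) x = - tscale c x"
  by (auto simp: tscale_def fun_eq_iff algebra_simps)

text \<open>Two facts about the charts matter later: tangent vectors form a vector space, because all charts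
  around a point describe the same vectors, and every tangent vector is the value of some vector
  field, because a constant field in a chart can be cut off by a bump function.\<close>

locale manifold_atlas =
  fixes A :: "('m::{t2_space, second_countable_topology}, 'e::euclidean_space) chart set"
  assumes smooth_manifold: "smooth_manifold A"
begin

lemma chart:
  assumes "(U, \<psi>) \<in> A"
  shows "open U" "open (\<psi> ` U)" "continuous_on U \<psi>" "continuous_on (\<psi> ` U) (inv_into U \<psi>)"
    and "x \<in> U \<Longrightarrow> inv_into U \<psi> (\<psi> x) = x"
proof -
  have *: "open U" "open (\<psi> ` U)" "homeomorphism U (\<psi> ` U) \<psi> (inv_into U \<psi>)"
    using smooth_manifold assms unfolding smooth_manifold_def by auto
  then show "open U" "open (\<psi> ` U)" "continuous_on U \<psi>" "continuous_on (\<psi> ` U) (inv_into U \<psi>)"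
    by (auto simp: homeomorphism_def)
  show "x \<in> U \<Longrightarrow> inv_into U \<psi> (\<psi> x) = x" using *(3) by (auto simp: homeomorphism_def)
qed

lemma chart_around: obtains U \<psi> where "(U, \<psi>) \<in> A" "p \<in> U"
proof -
  have "p \<in> (\<Union>(U, \<psi>)\<in>A. U)" using smooth_manifold unfolding smooth_manifold_def by simp
  then show ?thesis using that by auto
qed

lemma chart_image_open:
  assumes "(U, \<psi>) \<in> A" "open W"
  shows "open (\<psi> ` (U \<inter> W))"
proof -
  have "\<psi> ` (U \<inter> W) = inv_into U \<psi> -` W \<inter> \<psi> ` U"
    using chart(5)[OF assms(1)] by auto
  then show ?thesis
    using continuous_on_open_vimage[OF chart(2)[OF assms(1)], THEN iffD1, OF chart(4)[OF assms(1)]]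
      assms(2) by auto
qed

lemma transition_smooth:
  "(U, \<psi>) \<in> A \<Longrightarrow> (V, \<psi>') \<in> A \<Longrightarrow> smooth_on (\<psi> ` (U \<inter> V)) (\<psi>' \<circ> inv_into U \<psi>)"
  using smooth_manifold unfolding smooth_manifold_def by blast

lemma smooth_on_has_derivative:
  "smooth_on S f \<Longrightarrow> y \<in> S \<Longrightarrow> (f has_derivative frechet_derivative f (at y)) (at y)"
  unfolding smooth_on_def using Ck_on_SucD(1) by blast

lemma smooth_functions_Ck:
  "f \<in> smooth_functions A \<longleftrightarrow>
    (\<forall>(U, \<psi>)\<in>A. \<forall>k. Ck_on k (\<psi> ` U) (\<lambda>y. f (inv_into U \<psi> y)))"
  by (auto simp: smooth_functions_def smooth_on_def o_def)

lemma smooth_const [simp]: "(\<lambda>p. c) \<in> smooth_functions A"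
  by (auto simp: smooth_functions_Ck chart(2) intro: Ck_on_const)

lemma smooth_add:
  "f \<in> smooth_functions A \<Longrightarrow> h \<in> smooth_functions A \<Longrightarrow> (\<lambda>p. f p + h p) \<in> smooth_functions A"
  by (fastforce simp: smooth_functions_Ck intro: Ck_on_add chart(2))

lemma smooth_mult:
  "f \<in> smooth_functions A \<Longrightarrow> h \<in> smooth_functions A \<Longrightarrow> (\<lambda>p. f p * h p) \<in> smooth_functions A"
  by (fastforce simp: smooth_functions_Ck intro: Ck_on_mult chart(2))

lemma chart_derivative:
  assumes "f \<in> smooth_functions A" "(U, \<psi>) \<in> A" "p \<in> U"
  shows "(f \<circ> inv_into U \<psi> has_derivative frechet_derivative (f \<circ> inv_into U \<psi>) (at (\<psi> p))) (at (\<psi> p))"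
  using assms by (intro smooth_on_has_derivative[of "\<psi> ` U"]) (auto simp: smooth_functions_def)

lemma chart_vector_linear:
  assumes "(U, \<psi>) \<in> A" "p \<in> U"
  shows "chart_vector A (U, \<psi>) p (u + v) = chart_vector A (U, \<psi>) p u + chart_vector A (U, \<psi>) p v"
    and "chart_vector A (U, \<psi>) p (r *\<^sub>R u) = tscale r (chart_vector A (U, \<psi>) p u)"
  using has_derivative_linear[OF chart_derivative[OF _ assms]]
  by (auto simp: chart_vector_def fun_eq_iff tscale_def linear_add linear_scale)

text \<open>This is the chain rule for a change of charts. It makes the tangent space at \<open>p\<close> the image of a single
  linear map, hence closed under sums; in the defining union over charts the summands may come from
  different charts.\<close>

lemma chart_vector_change:
  assumes c: "(U, \<psi>) \<in> A" "p \<in> U" and c': "(V, \<psi>') \<in> A" "p \<in> V"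
  shows "chart_vector A (U, \<psi>) p u =
    chart_vector A (V, \<psi>') p (frechet_derivative (\<psi>' \<circ> inv_into U \<psi>) (at (\<psi> p)) u)"
proof -
  let ?t = "\<psi>' \<circ> inv_into U \<psi>"
  have "frechet_derivative (f \<circ> inv_into U \<psi>) (at (\<psi> p)) u =
      frechet_derivative (f \<circ> inv_into V \<psi>') (at (\<psi>' p)) (frechet_derivative ?t (at (\<psi> p)) u)"
    if f: "f \<in> smooth_functions A" for f
  proof -
    let ?S = "\<psi> ` (U \<inter> V)"
    have "(?t has_derivative frechet_derivative ?t (at (\<psi> p))) (at (\<psi> p))"
      by (rule smooth_on_has_derivative[OF transition_smooth[OF c(1) c'(1)]]) (use c c' in auto)
    moreover have "(f \<circ> inv_into V \<psi>' has_derivative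
        frechet_derivative (f \<circ> inv_into V \<psi>') (at (\<psi>' p))) (at (?t (\<psi> p)))"
      using chart_derivative[OF f c'] chart(5)[OF c] by simp
    ultimately have "((f \<circ> inv_into V \<psi>') \<circ> ?t has_derivative
        frechet_derivative (f \<circ> inv_into V \<psi>') (at (\<psi>' p)) \<circ> frechet_derivative ?t (at (\<psi> p)))
        (at (\<psi> p))"
      by (rule diff_chain_at)
    then have "(f \<circ> inv_into U \<psi> has_derivative
        frechet_derivative (f \<circ> inv_into V \<psi>') (at (\<psi>' p)) \<circ> frechet_derivative ?t (at (\<psi> p)))
        (at (\<psi> p))"
      by (rule has_derivative_transform_within_open[of _ _ _ _ ?S])
        (use c c' chart(5)[OF c(1)] chart(5)[OF c'(1)] chart_image_open[OF c(1) chart(1)[OF c'(1)]]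
          in auto)
    from frechet_derivative_at[OF this] show ?thesis by (metis comp_apply)
  qed
  then show ?thesis by (simp add: chart_vector_def fun_eq_iff)
qed

lemma tangent_space_chart:
  assumes "(U, \<psi>) \<in> A" "p \<in> U"
  shows "tangent_space A p = range (chart_vector A (U, \<psi>) p)"
proof
  show "tangent_space A p \<subseteq> range (chart_vector A (U, \<psi>) p)"
    using chart_vector_change[OF _ _ assms] by (fastforce simp: tangent_space_def)
  show "range (chart_vector A (U, \<psi>) p) \<subseteq> tangent_space A p"
    using assms by (force simp: tangent_space_def)
qed

lemma chart_vector_tangent:
  "(U, \<psi>) \<in> A \<Longrightarrow> p \<in> U \<Longrightarrow> chart_vector A (U, \<psi>) p u \<in> tangent_space A p"
  by (simp add: tangent_space_chart)

lemma tangent_add: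
  assumes "x \<in> tangent_space A p" "y \<in> tangent_space A p"
  shows "x + y \<in> tangent_space A p"
proof -
  obtain U \<psi> where c: "(U, \<psi>) \<in> A" "p \<in> U" by (rule chart_around)
  then show ?thesis
    using assms chart_vector_linear(1)[OF c, symmetric] by (auto simp: tangent_space_chart[OF c])
qed

lemma tangent_scale:
  assumes "x \<in> tangent_space A p"
  shows "tscale r x \<in> tangent_space A p"
proof -
  obtain U \<psi> where c: "(U, \<psi>) \<in> A" "p \<in> U" by (rule chart_around)
  then show ?thesis
    using assms chart_vector_linear(2)[OF c, symmetric] by (auto simp: tangent_space_chart[OF c])
qed

lemma tangent_uminus: "x \<in> tangent_space A p \<Longrightarrow> - x \<in> tangent_space A p"
  using tangent_scale[of x p "- 1"] by (simp add: tscale_simps)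

lemma tangent_diff: "x \<in> tangent_space A p \<Longrightarrow> y \<in> tangent_space A p \<Longrightarrow> x - y \<in> tangent_space A p"
  using tangent_add[of x p "- y"] tangent_uminus[of y p] by simp

lemma tangent_zero: "0 \<in> tangent_space A p"
proof -
  obtain U \<psi> where c: "(U, \<psi>) \<in> A" "p \<in> U" by (rule chart_around)
  then have "chart_vector A (U, \<psi>) p 0 \<in> tangent_space A p" by (simp add: tangent_space_chart[OF c])
  from tangent_scale[OF this, of 0] show ?thesis by (simp add: tscale_simps)
qed

lemma tangent_const:
  assumes "x \<in> tangent_space A p"
  shows "x (\<lambda>q. c) = 0"
proof -
  obtain U \<psi> where c: "(U, \<psi>) \<in> A" "p \<in> U" by (rule chart_around)
  have "frechet_derivative (\<lambda>y. c) (at (\<psi> p)) u = 0" for u by simp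
  then show ?thesis using assms by (auto simp: tangent_space_chart[OF c] chart_vector_def o_def)
qed

lemma vf_tangent: "X \<in> vector_fields A \<Longrightarrow> X p \<in> tangent_space A p"
  by (simp add: vector_fields_def)

lemma vf_add: "X \<in> vector_fields A \<Longrightarrow> Y \<in> vector_fields A \<Longrightarrow> X + Y \<in> vector_fields A"
  by (auto simp: vector_fields_def act_def tangent_add smooth_add)

lemma vf_fscale: "a \<in> smooth_functions A \<Longrightarrow> X \<in> vector_fields A \<Longrightarrow> fscale a X \<in> vector_fields A"
proof -
  assume a: "a \<in> smooth_functions A" and X: "X \<in> vector_fields A"
  have "act (fscale a X) f = (\<lambda>p. a p * act X f p)" for f
    by (simp add: act_def fscale_def tscale_def)
  then show ?thesis
    using a X by (simp add: vector_fields_def smooth_mult) (simp add: fscale_def tangent_scale)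
qed

lemma vf_uminus: "X \<in> vector_fields A \<Longrightarrow> - X \<in> vector_fields A"
  using vf_fscale[OF smooth_const[of "- 1"], of X] by (simp add: fscale_def tscale_simps fun_Compl_def)

lemma vf_diff: "X \<in> vector_fields A \<Longrightarrow> Y \<in> vector_fields A \<Longrightarrow> X - Y \<in> vector_fields A"
  using vf_add[of X "- Y"] vf_uminus[of Y] by simp

lemma vf_zero: "0 \<in> vector_fields A"
  by (auto simp: vector_fields_def act_def tangent_zero)

lemma vf_sum: "finite I \<Longrightarrow> (\<And>i. i \<in> I \<Longrightarrow> X i \<in> vector_fields A) \<Longrightarrow> sum X I \<in> vector_fields A"
  by (induction rule: finite_induct) (auto intro: vf_add vf_zero)

text \<open>Applied to a smooth function, the cut-off field is smooth on the chart domain \<open>U\<close>, where it is a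
  product of smooth functions of the coordinates, and it vanishes off the compact preimage \<open>L\<close> of \<open>K\<close>.
  As \<open>L\<close> is closed (the manifold is Hausdorff), \<open>U\<close> and the complement of \<open>L\<close> form an open cover,
  and smoothness is a local property.\<close>

lemma chart_bump_field:
  assumes c: "(U, \<psi>) \<in> A" and K: "compact K" "K \<subseteq> \<psi> ` U"
    and h: "smooth_on UNIV h" "\<And>y. y \<notin> K \<Longrightarrow> h y = 0"
  shows "(\<lambda>q. if q \<in> U then tscale (h (\<psi> q)) (chart_vector A (U, \<psi>) q u) else 0)
    \<in> vector_fields A" (is "?X \<in> _")
  unfolding vector_fields_def
proof (intro CollectI conjI allI ballI)
  show "?X q \<in> tangent_space A q" for q
    using c by (simp add: tangent_zero tangent_scale chart_vector_tangent)
  fix f assume f: "f \<in> smooth_functions A"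
  define G where "G = (\<lambda>y. h y * frechet_derivative (f \<circ> inv_into U \<psi>) (at y) u)"
  have fC: "Ck_on k (\<psi> ` U) (f \<circ> inv_into U \<psi>)" for k
    using f c by (auto simp: smooth_functions_def smooth_on_def)
  have G: "Ck_on k (\<psi> ` U) G" for k
    unfolding G_def
    by (rule Ck_on_mult[OF chart(2)[OF c] _ Ck_on_SucD(2)[OF fC]])
      (rule Ck_on_subset[OF h(1)[unfolded smooth_on_def, rule_format] subset_UNIV])
  define L where "L = inv_into U \<psi> ` K"
  have "compact L"
    unfolding L_def using continuous_on_subset[OF chart(4)[OF c] K(2)] K(1)
    by (rule compact_continuous_image)
  then have openL: "open (- L)" by (simp add: compact_imp_closed open_Compl)
  have LU: "L \<subseteq> U" using K(2) by (auto simp: L_def intro!: inv_into_into)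
  have X_in: "act ?X f q = G (\<psi> q)" if "q \<in> U" for q
    using that f chart(5)[OF c that] by (simp add: act_def tscale_def chart_vector_def G_def)
  have X_out: "act ?X f q = 0" if "q \<notin> L" for q
  proof (cases "q \<in> U")
    case True
    then have "\<psi> q \<notin> K" using that chart(5)[OF c True] unfolding L_def by force
    then show ?thesis using True h(2) by (simp add: X_in G_def)
  qed (simp add: act_def)
  show "act ?X f \<in> smooth_functions A"
    unfolding smooth_functions_Ck
  proof clarify
    fix V \<psi>' k assume c': "(V, \<psi>') \<in> A"
    let ?F = "\<lambda>y. act ?X f (inv_into V \<psi>' y)"
    let ?S = "\<psi>' ` (V \<inter> U)" and ?T = "\<psi>' ` (V \<inter> - L)"
    have op: "open ?S" "open ?T" using chart_image_open[OF c'] chart(1)[OF c] openL by auto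
    have "Ck_on k ?S (\<lambda>y. G ((\<psi> \<circ> inv_into V \<psi>') y))"
      by (rule Ck_on_compose[where f = "\<psi> \<circ> inv_into V \<psi>'" and g = G, OF op(1) _ _ G])
        (use transition_smooth[OF c' c] chart(5)[OF c'] in \<open>auto simp: smooth_on_def\<close>)
    then have "Ck_on k ?S ?F"
      by (rule iffD1[OF Ck_on_cong[OF op(1)], rotated 1]) (auto simp: X_in chart(5)[OF c'])
    moreover have "Ck_on k ?T ?F"
      by (rule iffD1[OF Ck_on_cong[OF op(2)] Ck_on_const[OF op(2), of _ 0]])
        (auto simp: X_out chart(5)[OF c'])
    moreover have "\<psi>' ` V = ?S \<union> ?T" using LU by auto
    ultimately show "Ck_on k (\<psi>' ` V) ?F" using Ck_on_Un[OF op] by simp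
  qed
qed

text \<open>The choice behind \<open>extension\<close> has a candidate: the coordinates of \<open>x\<close> are divided by the value of the
  bump function at \<open>p\<close>, so that the cut-off field takes exactly the value \<open>x\<close> there.\<close>

lemma extension:
  assumes "x \<in> tangent_space A p"
  shows "extension A p x \<in> vector_fields A" "extension A p x p = x"
proof -
  obtain U \<psi> where c: "(U, \<psi>) \<in> A" "p \<in> U" by (rule chart_around)
  obtain u where u: "x = chart_vector A (U, \<psi>) p u" using assms by (auto simp: tangent_space_chart[OF c])
  obtain r where r: "r > 0" "cball (\<psi> p) r \<subseteq> \<psi> ` U"
    using chart(2)[OF c(1)] c(2) open_contains_cball by blast
  obtain h :: "'e \<Rightarrow> real" where
    h: "smooth_on UNIV h" "h (\<psi> p) \<noteq> 0" "\<And>y. y \<notin> cball (\<psi> p) r \<Longrightarrow> h y = 0"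
    using bump_function_exists[OF r(1)] by metis
  let ?X = "\<lambda>q. if q \<in> U then tscale (h (\<psi> q))
      (chart_vector A (U, \<psi>) q (inverse (h (\<psi> p)) *\<^sub>R u)) else 0"
  have "?X \<in> vector_fields A" by (rule chart_bump_field[OF c(1) compact_cball r(2) h(1,3)])
  moreover have "?X p = x"
    using c h(2) by (simp add: chart_vector_linear(2) tscale_simps u)
  ultimately have "\<exists>X. X \<in> vector_fields A \<and> X p = x" by blast
  then have "extension A p x \<in> vector_fields A \<and> extension A p x p = x"
    unfolding extension_def by (rule someI_ex)
  then show "extension A p x \<in> vector_fields A" "extension A p x p = x" by auto
qed

end

section \<open>The Levi-Civita connection\<close>

lemma sum_fun_apply: "(\<Sum>i\<in>I. f i) x = (\<Sum>i\<in>I. f i x)"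
  by (induction I rule: infinite_finite_induct) auto

lemma app_apply: "app T X p = T p (X p)" "app2 S X Y p = S p (X p) (Y p)"
  by (simp_all add: app_def app2_def)

locale riemannian_manifold = manifold_atlas A
  for A :: "('m::{t2_space, second_countable_topology}, 'e::euclidean_space) chart set" +
  fixes g :: "'m \<Rightarrow> 'm tangent \<Rightarrow> 'm tangent \<Rightarrow> real" and D :: "'m connection"
  assumes metric: "riemannian_metric A g" and levi_civita: "levi_civita A g D"
begin

abbreviation "T \<equiv> tangent_space A"
abbreviation "VF \<equiv> vector_fields A"

lemma g_sym: "x \<in> T p \<Longrightarrow> y \<in> T p \<Longrightarrow> g p x y = g p y x"
  using metric unfolding riemannian_metric_def by blast

lemma g_add_left: "x \<in> T p \<Longrightarrow> y \<in> T p \<Longrightarrow> z \<in> T p \<Longrightarrow> g p (x + y) z = g p x z + g p y z"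
  using metric unfolding riemannian_metric_def by blast

lemma g_scale_left: "x \<in> T p \<Longrightarrow> y \<in> T p \<Longrightarrow> g p (tscale c x) y = c * g p x y"
  using metric unfolding riemannian_metric_def by blast

lemma g_uminus_left: "x \<in> T p \<Longrightarrow> y \<in> T p \<Longrightarrow> g p (- x) y = - g p x y"
  using g_scale_left[of x p y "- 1"] by (simp add: tscale_simps)

lemma g_diff_left: "x \<in> T p \<Longrightarrow> y \<in> T p \<Longrightarrow> z \<in> T p \<Longrightarrow> g p (x - y) z = g p x z - g p y z"
  using g_add_left[of x p "- y" z] by (simp add: g_uminus_left tangent_uminus)

lemma g_zero_left: "x \<in> T p \<Longrightarrow> g p 0 x = 0"
  using g_scale_left[of 0 p x 0] by (simp add: tscale_simps tangent_zero)

lemmas g_left = g_add_left g_scale_left g_uminus_left g_diff_left g_zero_left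

lemma g_add_right: "x \<in> T p \<Longrightarrow> y \<in> T p \<Longrightarrow> z \<in> T p \<Longrightarrow> g p z (x + y) = g p z x + g p z y"
  using g_add_left[of x p y z] by (simp add: g_sym tangent_add)

lemma g_scale_right: "x \<in> T p \<Longrightarrow> y \<in> T p \<Longrightarrow> g p y (tscale c x) = c * g p y x"
  using g_scale_left[of x p y c] by (simp add: g_sym tangent_scale)

lemma g_uminus_right: "x \<in> T p \<Longrightarrow> y \<in> T p \<Longrightarrow> g p y (- x) = - g p y x"
  using g_uminus_left[of x p y] by (simp add: g_sym tangent_uminus)

lemma g_diff_right: "x \<in> T p \<Longrightarrow> y \<in> T p \<Longrightarrow> z \<in> T p \<Longrightarrow> g p z (x - y) = g p z x - g p z y"
  using g_diff_left[of x p y z] by (simp add: g_sym tangent_diff)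

lemma g_sum_left:
  "finite I \<Longrightarrow> (\<And>i. i \<in> I \<Longrightarrow> v i \<in> T p) \<Longrightarrow> x \<in> T p \<Longrightarrow>
    (\<Sum>i\<in>I. v i) \<in> T p \<and> g p (\<Sum>i\<in>I. v i) x = (\<Sum>i\<in>I. g p (v i) x)"
  by (induction rule: finite_induct) (auto simp: g_left tangent_zero tangent_add)

lemma g_positive: "x \<in> T p \<Longrightarrow> x \<noteq> 0 \<Longrightarrow> g p x x > 0"
  using metric unfolding riemannian_metric_def by blast

lemma g_definite: "x \<in> T p \<Longrightarrow> g p x x = 0 \<Longrightarrow> x = 0"
  by (metis g_positive less_irrefl)

lemma g_smooth: "X \<in> VF \<Longrightarrow> Y \<in> VF \<Longrightarrow> app2 g X Y \<in> smooth_functions A"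
  using metric unfolding riemannian_metric_def by blast

lemma D_vf: "X \<in> VF \<Longrightarrow> Y \<in> VF \<Longrightarrow> D X Y \<in> VF"
  using levi_civita unfolding levi_civita_def linear_connection_def by blast

lemma D_add: "X \<in> VF \<Longrightarrow> Y \<in> VF \<Longrightarrow> Z \<in> VF \<Longrightarrow> D X (Y + Z) = D X Y + D X Z"
  using levi_civita unfolding levi_civita_def linear_connection_def by blast

lemma D_leibniz:
  assumes "X \<in> VF" "Y \<in> VF" "f \<in> smooth_functions A"
  shows "D X (fscale f Y) p = tscale (act X f p) (Y p) + tscale (f p) (D X Y p)"
proof -
  have "D X (fscale f Y) = fscale (act X f) Y + fscale f (D X Y)"
    using levi_civita assms unfolding levi_civita_def linear_connection_def by blast
  then show ?thesis by (simp add: fscale_def)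
qed

lemma D_zero: "X \<in> VF \<Longrightarrow> D X 0 = 0"
  by (metis D_add vf_zero add_0_right add_cancel_right_right)

lemma D_sum:
  "finite I \<Longrightarrow> X \<in> VF \<Longrightarrow> (\<And>i. i \<in> I \<Longrightarrow> Y i \<in> VF) \<Longrightarrow> D X (\<Sum>i\<in>I. Y i) = (\<Sum>i\<in>I. D X (Y i))"
  by (induction rule: finite_induct) (auto simp: D_zero D_add vf_sum)

lemma torsion_free: "X \<in> VF \<Longrightarrow> Y \<in> VF \<Longrightarrow> bracket X Y = D X Y - D Y X"
  using levi_civita unfolding levi_civita_def by simp

lemma bracket_vf: "X \<in> VF \<Longrightarrow> Y \<in> VF \<Longrightarrow> bracket X Y \<in> VF"
  by (simp add: torsion_free vf_diff D_vf)

lemma act_metric: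
  assumes "X \<in> VF" "Y \<in> VF" "Z \<in> VF"
  shows "act X (app2 g Y Z) p = g p (D X Y p) (Z p) + g p (Y p) (D X Z p)"
proof -
  have "act X (app2 g Y Z) = app2 g (D X Y) Z + app2 g Y (D X Z)"
    using levi_civita assms unfolding levi_civita_def by blast
  then show ?thesis by (simp add: app2_def)
qed

end

section \<open>Sasakian structures\<close>

locale sasakian_manifold = riemannian_manifold A g D
  for A :: "('m::{t2_space, second_countable_topology}, 'e::euclidean_space) chart set" and g D +
  fixes \<phi> :: "'m \<Rightarrow> 'm tangent \<Rightarrow> 'm tangent" and \<eta> :: "'m \<Rightarrow> 'm tangent \<Rightarrow> real"
    and \<xi> :: "'m vfield"
  assumes sasakian: "sasakian A g D \<phi> \<eta> \<xi>"
begin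

lemma phi_tangent: "x \<in> T p \<Longrightarrow> \<phi> p x \<in> T p"
  using sasakian unfolding sasakian_def endo_tensor_def by blast

lemma phi_add: "x \<in> T p \<Longrightarrow> y \<in> T p \<Longrightarrow> \<phi> p (x + y) = \<phi> p x + \<phi> p y"
  using sasakian unfolding sasakian_def endo_tensor_def by blast

lemma phi_scale: "x \<in> T p \<Longrightarrow> \<phi> p (tscale c x) = tscale c (\<phi> p x)"
  using sasakian unfolding sasakian_def endo_tensor_def by blast

lemma phi_uminus: "x \<in> T p \<Longrightarrow> \<phi> p (- x) = - \<phi> p x"
  using phi_scale[of x p "- 1"] by (simp add: tscale_simps)

lemma phi_diff: "x \<in> T p \<Longrightarrow> y \<in> T p \<Longrightarrow> \<phi> p (x - y) = \<phi> p x - \<phi> p y"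
  using phi_add[of x p "- y"] by (simp add: phi_uminus tangent_uminus)

lemma phi_vf: "X \<in> VF \<Longrightarrow> app \<phi> X \<in> VF"
  using sasakian unfolding sasakian_def endo_tensor_def by blast

lemma eta_smooth: "X \<in> VF \<Longrightarrow> app \<eta> X \<in> smooth_functions A"
  using sasakian unfolding sasakian_def one_form_def by blast

lemma xi_vf: "\<xi> \<in> VF"
  using sasakian unfolding sasakian_def by blast

lemma xi_tangent: "\<xi> p \<in> T p"
  by (rule vf_tangent[OF xi_vf])

lemma phi_phi: "x \<in> T p \<Longrightarrow> \<phi> p (\<phi> p x) = - x + tscale (\<eta> p x) (\<xi> p)"
  using sasakian unfolding sasakian_def by blast

lemma eta_xi: "\<eta> p (\<xi> p) = 1"
  using sasakian unfolding sasakian_def by blast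

lemma eta_eq: "x \<in> T p \<Longrightarrow> \<eta> p x = g p (\<xi> p) x"
  using sasakian unfolding sasakian_def by blast

lemma eta_uminus: "x \<in> T p \<Longrightarrow> \<eta> p (- x) = - \<eta> p x"
  by (simp add: eta_eq tangent_uminus g_uminus_right xi_tangent)

lemma g_phi_phi: "x \<in> T p \<Longrightarrow> y \<in> T p \<Longrightarrow> g p (\<phi> p x) (\<phi> p y) = g p x y - \<eta> p x * \<eta> p y"
  using sasakian unfolding sasakian_def by blast

lemma D_phi:
  "X \<in> VF \<Longrightarrow> Y \<in> VF \<Longrightarrow> D X (app \<phi> Y) - app \<phi> (D X Y) = fscale (app2 g X Y) \<xi> - fscale (app \<eta> Y) X"
  using sasakian unfolding sasakian_def by blast

lemma phi_xi: "\<phi> p (\<xi> p) = 0"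
proof (rule g_definite)
  show "g p (\<phi> p (\<xi> p)) (\<phi> p (\<xi> p)) = 0"
    using eta_eq[OF xi_tangent] by (simp add: g_phi_phi xi_tangent eta_xi)
qed (simp add: phi_tangent xi_tangent)

text \<open>Evaluating \<open>\<phi>\<^sup>3\<close> in the two possible ways leaves the multiple \<open>\<eta> (\<phi> x)\<close> of \<open>\<xi>\<close>, which must vanish.\<close>

lemma eta_phi: "x \<in> T p \<Longrightarrow> \<eta> p (\<phi> p x) = 0"
proof -
  assume x: "x \<in> T p"
  have "\<phi> p (\<phi> p (\<phi> p x)) = - \<phi> p x"
    using x by (simp add: phi_phi[of x] phi_diff phi_uminus phi_scale phi_xi tangent_uminus
        tangent_scale xi_tangent tscale_simps)
  then have "tscale (\<eta> p (\<phi> p x)) (\<xi> p) = 0"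
    using phi_phi[OF phi_tangent[OF x]] by simp
  then have "\<eta> p (\<phi> p x) * g p (\<xi> p) (\<xi> p) = 0"
    using g_scale_left[OF xi_tangent xi_tangent] by (metis g_zero_left xi_tangent)
  then show ?thesis using eta_eq[OF xi_tangent] eta_xi by simp
qed

text \<open>Replacing \<open>y\<close> by \<open>\<phi> y\<close> in the compatibility of \<open>g\<close> and \<open>\<phi>\<close> turns it into skew-symmetry.\<close>

lemma phi_skew:
  assumes "x \<in> T p" "y \<in> T p"
  shows "g p (\<phi> p x) y = - g p x (\<phi> p y)"
proof -
  have "g p (\<phi> p x) (\<phi> p (\<phi> p y)) = g p x (\<phi> p y)"
    using assms by (simp add: g_phi_phi phi_tangent eta_phi)
  moreover have "g p (\<phi> p x) (\<phi> p (\<phi> p y)) = - g p (\<phi> p x) y + \<eta> p y * g p (\<phi> p x) (\<xi> p)"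
    using assms by (simp add: phi_phi g_diff_right g_scale_right phi_tangent xi_tangent
        tangent_scale tangent_uminus)
  moreover have "g p (\<phi> p x) (\<xi> p) = 0"
    using assms eta_phi eta_eq g_sym phi_tangent xi_tangent by metis
  ultimately show ?thesis by simp
qed

lemma g_phi_self: "x \<in> T p \<Longrightarrow> g p (\<phi> p x) x = 0"
  using phi_skew[of x p x] g_sym[of x p "\<phi> p x"] by (simp add: phi_tangent)

text \<open>The formula for \<open>\<nabla>\<phi>\<close> applied to \<open>\<phi> \<xi> = 0\<close> determines \<open>\<phi> (\<nabla>\<^sub>X \<xi>)\<close>, hence \<open>\<nabla>\<^sub>X \<xi>\<close> up to a multiple of \<open>\<xi>\<close>;
  that multiple is zero because \<open>\<xi>\<close> has constant length.\<close>

lemma D_xi: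
  assumes "X \<in> VF"
  shows "D X \<xi> p = - \<phi> p (X p)"
proof -
  let ?d = "D X \<xi> p"
  have X: "X p \<in> T p" and d: "?d \<in> T p" using assms D_vf xi_vf vf_tangent by auto
  have "app \<phi> \<xi> = 0" by (simp add: app_def phi_xi fun_eq_iff)
  then have "D X (app \<phi> \<xi>) p = 0" using D_zero[OF assms] by simp
  with D_phi[OF assms xi_vf, THEN fun_cong, of p]
  have "\<phi> p ?d = X p - tscale (\<eta> p (X p)) (\<xi> p)"
    using X by (simp add: app_def app2_def fscale_def eta_xi tscale_simps eta_eq g_sym xi_tangent
        algebra_simps)
  then have "\<phi> p (\<phi> p ?d) = \<phi> p (X p)"
    using X by (simp add: phi_diff phi_scale tangent_scale xi_tangent phi_xi tscale_simps)
  moreover have "\<eta> p ?d = 0"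
  proof -
    have "app2 g \<xi> \<xi> = (\<lambda>q. 1)"
      using eta_eq[OF xi_tangent] by (simp add: app2_def eta_xi fun_eq_iff)
    then have "act X (app2 g \<xi> \<xi>) p = 0" using tangent_const[OF X] by (simp add: act_def)
    then show ?thesis
      using act_metric[OF assms xi_vf xi_vf, of p] d by (simp add: eta_eq g_sym xi_tangent)
  qed
  ultimately have "- ?d = \<phi> p (X p)" using phi_phi[OF d] by (simp add: tscale_simps)
  then show ?thesis by (metis minus_minus)
qed

lemma act_eta:
  assumes "X \<in> VF" "Y \<in> VF"
  shows "act X (app \<eta> Y) p = \<eta> p (D X Y p) - g p (\<phi> p (X p)) (Y p)"
proof -
  have "app \<eta> Y = app2 g \<xi> Y"
    using assms by (simp add: app_def app2_def eta_eq vf_tangent fun_eq_iff)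
  then show ?thesis
    using assms by (simp add: act_metric xi_vf D_xi g_uminus_left phi_tangent vf_tangent eta_eq D_vf)
qed

text \<open>Since \<open>\<nabla>\<^sub>X \<xi> = - \<phi> X\<close>, this tensor is the contribution of one Sasakian structure to the difference
  between the modified connection and the Levi-Civita connection.\<close>

definition bar_term :: "'m vfield \<Rightarrow> 'm vfield \<Rightarrow> 'm vfield" where
  "bar_term X Y = fscale (app \<eta> X) (app \<phi> Y) + fscale (app \<eta> Y) (app \<phi> X)
    + fscale (app2 (Omega g \<phi>) X Y) \<xi>"

lemma Omega_smooth: "X \<in> VF \<Longrightarrow> Y \<in> VF \<Longrightarrow> app2 (Omega g \<phi>) X Y \<in> smooth_functions A"
  using g_smooth[of X "app \<phi> Y"] by (simp add: app2_def Omega_def app_def phi_vf[unfolded app_def])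

lemma bar_term_vf: "X \<in> VF \<Longrightarrow> Y \<in> VF \<Longrightarrow> bar_term X Y \<in> VF"
  by (simp add: bar_term_def vf_add vf_fscale eta_smooth phi_vf Omega_smooth xi_vf)

lemma g_bar_term:
  assumes "X \<in> VF" "Y \<in> VF" "w \<in> T p" "\<eta> p w = 0"
  shows "g p (bar_term X Y p) w = \<eta> p (X p) * g p (\<phi> p (Y p)) w + \<eta> p (Y p) * g p (\<phi> p (X p)) w"
  using assms eta_eq[of w p]
  by (simp add: bar_term_def fscale_def app_def app2_def g_left tangent_add tangent_scale phi_tangent
      xi_tangent vf_tangent)

lemma bar_term_horizontal:
  assumes "\<eta> p (X p) = 0" "\<eta> p (Y p) = 0"
  shows "bar_term X Y p = tscale (g p (X p) (\<phi> p (Y p))) (\<xi> p)"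
  using assms by (simp add: bar_term_def fscale_def app_def app2_def Omega_def tscale_simps)

text \<open>The coefficients \<open>\<eta> Y\<close> and \<open>\<eta> Z\<close> vanish at \<open>p\<close> but perhaps not around it, so only their derivatives
  survive; of the term along \<open>\<xi>\<close> only \<open>\<nabla>\<^sub>X \<xi> = - \<phi> X\<close> has a part seen by \<open>w\<close>.\<close>

lemma g_D_bar_term:
  assumes vf: "X \<in> VF" "Y \<in> VF" "Z \<in> VF" and w: "w \<in> T p" "\<eta> p w = 0"
    and hor: "\<eta> p (Y p) = 0" "\<eta> p (Z p) = 0"
  shows "g p (D X (bar_term Y Z) p) w = act X (app \<eta> Y) p * g p (\<phi> p (Z p)) w
    + act X (app \<eta> Z) p * g p (\<phi> p (Y p)) w - g p (Y p) (\<phi> p (Z p)) * g p (\<phi> p (X p)) w"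
proof -
  have "D X (bar_term Y Z) p = D X (fscale (app \<eta> Y) (app \<phi> Z)) p + D X (fscale (app \<eta> Z) (app \<phi> Y)) p
      + D X (fscale (app2 (Omega g \<phi>) Y Z) \<xi>) p"
    using vf by (simp add: bar_term_def D_add vf_add vf_fscale eta_smooth phi_vf Omega_smooth xi_vf)
  also have "\<dots> = tscale (act X (app \<eta> Y) p) (\<phi> p (Z p)) + tscale (act X (app \<eta> Z) p) (\<phi> p (Y p))
      + (tscale (act X (app2 (Omega g \<phi>) Y Z) p) (\<xi> p)
         - tscale (g p (Y p) (\<phi> p (Z p))) (\<phi> p (X p)))"
    using vf hor
    by (simp add: D_leibniz eta_smooth phi_vf Omega_smooth xi_vf D_xi app_apply
        Omega_def tscale_simps)
  finally show ?thesis
    using vf w eta_eq[of w p]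
    by (simp add: g_left tangent_add tangent_scale tangent_diff phi_tangent xi_tangent vf_tangent)
qed

end

section \<open>Families of Sasakian structures and the modified connection\<close>

text \<open>The comparison of curvatures is a computation with one structure at a time, in which two structures
  meet only through \<open>\<eta>\<^sub>\<alpha> (\<xi>\<^sub>\<beta>) = 0\<close>. The setting for it is therefore a finite family of Sasakian
  structures with orthogonal Reeb fields.\<close>

locale sasakian_family = riemannian_manifold A g D
  for A :: "('m::{t2_space, second_countable_topology}, 'e::euclidean_space) chart set" and g D +
  fixes I :: "'i set" and \<phi> :: "'i \<Rightarrow> 'm \<Rightarrow> 'm tangent \<Rightarrow> 'm tangent"
    and \<eta> :: "'i \<Rightarrow> 'm \<Rightarrow> 'm tangent \<Rightarrow> real" and \<xi> :: "'i \<Rightarrow> 'm vfield"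
  assumes finite_I: "finite I"
    and family: "\<alpha> \<in> I \<Longrightarrow> sasakian A g D (\<phi> \<alpha>) (\<eta> \<alpha>) (\<xi> \<alpha>)"
    and orthogonal: "\<alpha> \<in> I \<Longrightarrow> \<beta> \<in> I \<Longrightarrow> \<alpha> \<noteq> \<beta> \<Longrightarrow> \<eta> \<alpha> p (\<xi> \<beta> p) = 0"
begin

lemma member: "\<alpha> \<in> I \<Longrightarrow> sasakian_manifold A g D (\<phi> \<alpha>) (\<eta> \<alpha>) (\<xi> \<alpha>)"
  by (intro sasakian_manifold.intro sasakian_manifold_axioms.intro family riemannian_manifold_axioms)

abbreviation "bar_terms \<alpha> \<equiv> sasakian_manifold.bar_term g (\<phi> \<alpha>) (\<eta> \<alpha>) (\<xi> \<alpha>)"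

definition bar :: "'m connection" where
  "bar X Y = D X Y + (\<Sum>\<alpha>\<in>I. bar_terms \<alpha> X Y)"

definition horizontal :: "'m \<Rightarrow> 'm tangent \<Rightarrow> bool" where
  "horizontal p x \<longleftrightarrow> x \<in> T p \<and> (\<forall>\<alpha>\<in>I. \<eta> \<alpha> p x = 0)"

lemma horizontal_tangent: "horizontal p x \<Longrightarrow> x \<in> T p"
  by (simp add: horizontal_def)

lemma horizontal_eta: "horizontal p x \<Longrightarrow> \<alpha> \<in> I \<Longrightarrow> \<eta> \<alpha> p x = 0"
  by (simp add: horizontal_def)

lemmas bar_terms_vf = sasakian_manifold.bar_term_vf[OF member]

lemma sum_bar_terms_vf: "X \<in> VF \<Longrightarrow> Y \<in> VF \<Longrightarrow> (\<Sum>\<alpha>\<in>I. bar_terms \<alpha> X Y) \<in> VF"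
  by (intro vf_sum finite_I bar_terms_vf)

lemma bar_vf: "X \<in> VF \<Longrightarrow> Y \<in> VF \<Longrightarrow> bar X Y \<in> VF"
  by (simp add: bar_def vf_add D_vf sum_bar_terms_vf)

lemma g_sum_field:
  assumes "\<And>\<alpha>. \<alpha> \<in> I \<Longrightarrow> F \<alpha> \<in> VF" "w \<in> T p"
  shows "g p ((\<Sum>\<alpha>\<in>I. F \<alpha>) p) w = (\<Sum>\<alpha>\<in>I. g p (F \<alpha> p) w)"
  using g_sum_left[OF finite_I, of "\<lambda>\<alpha>. F \<alpha> p" p w] assms by (simp add: sum_fun_apply vf_tangent)

lemma g_bar:
  assumes "X \<in> VF" "Y \<in> VF" and w: "horizontal p w"
  shows "g p (bar X Y p) w = g p (D X Y p) w + (\<Sum>\<alpha>\<in>I.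
    \<eta> \<alpha> p (X p) * g p (\<phi> \<alpha> p (Y p)) w + \<eta> \<alpha> p (Y p) * g p (\<phi> \<alpha> p (X p)) w)"
proof -
  have "g p ((\<Sum>\<alpha>\<in>I. bar_terms \<alpha> X Y) p) w = (\<Sum>\<alpha>\<in>I. g p (bar_terms \<alpha> X Y p) w)"
    using assms by (intro g_sum_field bar_terms_vf) (auto simp: horizontal_def)
  also have "\<dots> = (\<Sum>\<alpha>\<in>I.
      \<eta> \<alpha> p (X p) * g p (\<phi> \<alpha> p (Y p)) w + \<eta> \<alpha> p (Y p) * g p (\<phi> \<alpha> p (X p)) w)"
    using assms by (intro sum.cong refl sasakian_manifold.g_bar_term[OF member]) (auto simp: horizontal_def)
  finally show ?thesis
    using assms
    by (simp add: bar_def g_add_left vf_tangent D_vf sum_bar_terms_vf horizontal_def)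
qed

lemma eta_bar_horizontal:
  assumes vf: "X \<in> VF" "Y \<in> VF" and hor: "horizontal p (X p)" "horizontal p (Y p)" and \<alpha>: "\<alpha> \<in> I"
  shows "\<eta> \<alpha> p (bar X Y p) = \<eta> \<alpha> p (D X Y p) + g p (X p) (\<phi> \<alpha> p (Y p))"
proof -
  interpret a: sasakian_manifold A g D "\<phi> \<alpha>" "\<eta> \<alpha>" "\<xi> \<alpha>" by (rule member[OF \<alpha>])
  have "g p ((\<Sum>\<beta>\<in>I. bar_terms \<beta> X Y) p) (\<xi> \<alpha> p) = (\<Sum>\<beta>\<in>I. g p (bar_terms \<beta> X Y p) (\<xi> \<alpha> p))"
    using vf by (intro g_sum_field bar_terms_vf a.xi_tangent)
  also have "\<dots> = (\<Sum>\<beta>\<in>I. if \<beta> = \<alpha> then g p (X p) (\<phi> \<alpha> p (Y p)) else 0)"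
  proof (intro sum.cong refl)
    fix \<beta> assume \<beta>: "\<beta> \<in> I"
    interpret b: sasakian_manifold A g D "\<phi> \<beta>" "\<eta> \<beta>" "\<xi> \<beta>" by (rule member[OF \<beta>])
    have "g p (\<xi> \<beta> p) (\<xi> \<alpha> p) = (if \<beta> = \<alpha> then 1 else 0)"
      using orthogonal[OF \<beta> \<alpha>, of p] a.eta_xi[of p] b.eta_eq[OF a.xi_tangent, of p] by auto
    then show "g p (bar_terms \<beta> X Y p) (\<xi> \<alpha> p) = (if \<beta> = \<alpha> then g p (X p) (\<phi> \<alpha> p (Y p)) else 0)"
      using hor \<beta> by (auto simp: b.bar_term_horizontal horizontal_def g_scale_left b.xi_tangent a.xi_tangent)
  qed
  finally show ?thesis
    using vf \<alpha> finite_I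
    by (simp add: a.eta_eq vf_tangent bar_vf D_vf sum_bar_terms_vf bar_def a.xi_tangent
        g_add_right g_sym[of "\<xi> \<alpha> p"] tangent_add)
qed

lemma g_D_bar:
  assumes vf: "X \<in> VF" "Y \<in> VF" "Z \<in> VF"
    and hor: "horizontal p w" "horizontal p (Y p)" "horizontal p (Z p)"
  shows "g p (D X (bar Y Z) p) w = g p (D X (D Y Z) p) w + (\<Sum>\<alpha>\<in>I.
    (\<eta> \<alpha> p (D X Y p) - g p (\<phi> \<alpha> p (X p)) (Y p)) * g p (\<phi> \<alpha> p (Z p)) w
    + (\<eta> \<alpha> p (D X Z p) - g p (\<phi> \<alpha> p (X p)) (Z p)) * g p (\<phi> \<alpha> p (Y p)) w
    - g p (Y p) (\<phi> \<alpha> p (Z p)) * g p (\<phi> \<alpha> p (X p)) w)"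
proof -
  have "D X (bar Y Z) = D X (D Y Z) + (\<Sum>\<alpha>\<in>I. D X (bar_terms \<alpha> Y Z))"
    using vf by (simp add: bar_def D_add D_vf sum_bar_terms_vf D_sum[OF finite_I] bar_terms_vf)
  moreover have "g p ((\<Sum>\<alpha>\<in>I. D X (bar_terms \<alpha> Y Z)) p) w = (\<Sum>\<alpha>\<in>I. g p (D X (bar_terms \<alpha> Y Z) p) w)"
    using assms by (intro g_sum_field D_vf bar_terms_vf) (auto simp: horizontal_def)
  moreover have "\<dots> = (\<Sum>\<alpha>\<in>I.
    (\<eta> \<alpha> p (D X Y p) - g p (\<phi> \<alpha> p (X p)) (Y p)) * g p (\<phi> \<alpha> p (Z p)) w
    + (\<eta> \<alpha> p (D X Z p) - g p (\<phi> \<alpha> p (X p)) (Z p)) * g p (\<phi> \<alpha> p (Y p)) w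
    - g p (Y p) (\<phi> \<alpha> p (Z p)) * g p (\<phi> \<alpha> p (X p)) w)"
    using assms
    by (intro sum.cong refl, subst sasakian_manifold.g_D_bar_term[OF member])
      (auto simp: horizontal_def sasakian_manifold.act_eta[OF member])
  ultimately show ?thesis
    using vf hor(1)
    by (simp add: g_add_left vf_tangent D_vf vf_sum[OF finite_I] bar_terms_vf horizontal_def)
qed

text \<open>Write \<open>t\<close> for \<open>g (\<phi> y, x)\<close>. The derivatives \<open>\<eta> (\<nabla>\<^sub>X Y)\<close> and \<open>\<eta> (\<nabla>\<^sub>Y X)\<close>, called \<open>a\<close> and \<open>b\<close>, depend on how \<open>x\<close>
  and \<open>y\<close> are extended to vector fields. Each structure adds \<open>2 (a + t) t\<close> through
  \<open>\<nabla>\<^sub>X \<nabla>\<^sub>Y Y\<close>, subtracts \<open>(b - t) t - t\<^sup>2\<close> and \<open>(a + t) t\<close> through \<open>\<nabla>\<^sub>Y \<nabla>\<^sub>X Y\<close>, and subtracts \<open>(a - b) t\<close>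
  through the bracket. Everything that involves \<open>a\<close> and \<open>b\<close> cancels and \<open>3 t\<^sup>2\<close> remains; this is how the
  difference of the curvatures becomes independent of the extensions.\<close>

lemma g_curvature_bar:
  assumes vf: "X \<in> VF" "Y \<in> VF" and hor: "horizontal p (X p)" "horizontal p (Y p)"
  shows "g p (curvature bar X Y Y p) (X p) =
    g p (curvature D X Y Y p) (X p) + 3 * (\<Sum>\<alpha>\<in>I. (g p (\<phi> \<alpha> p (X p)) (Y p))\<^sup>2)"
proof -
  let ?x = "X p" and ?y = "Y p"
  define a where "a \<alpha> = \<eta> \<alpha> p (D X Y p)" for \<alpha>
  define b where "b \<alpha> = \<eta> \<alpha> p (D Y X p)" for \<alpha>
  define t where "t \<alpha> = g p (\<phi> \<alpha> p ?y) ?x" for \<alpha>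
  have T: "?x \<in> T p" "?y \<in> T p" using vf vf_tangent by auto
  have fam: "g p ?x (\<phi> \<alpha> p ?y) = t \<alpha>" "g p (\<phi> \<alpha> p ?x) ?y = - t \<alpha>"
    "g p (\<phi> \<alpha> p ?x) ?x = 0" "g p (\<phi> \<alpha> p ?y) ?y = 0" "g p ?y (\<phi> \<alpha> p ?y) = 0"
    "\<eta> \<alpha> p ?x = 0" "\<eta> \<alpha> p ?y = 0" "g p (\<phi> \<alpha> p ?y) ?x = t \<alpha>"
    "\<eta> \<alpha> p (bracket X Y p) = a \<alpha> - b \<alpha>"
    "\<eta> \<alpha> p (bar X Y p) = a \<alpha> + t \<alpha>" if \<alpha>: "\<alpha> \<in> I" for \<alpha>
  proof -
    interpret a: sasakian_manifold A g D "\<phi> \<alpha>" "\<eta> \<alpha>" "\<xi> \<alpha>" by (rule member[OF \<alpha>])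
    note P = a.phi_tangent[OF T(1)] a.phi_tangent[OF T(2)]
    show t: "g p (\<phi> \<alpha> p ?y) ?x = t \<alpha>" by (simp add: t_def)
    show t': "g p ?x (\<phi> \<alpha> p ?y) = t \<alpha>" using g_sym[OF T(1) P(2)] t by simp
    show "g p (\<phi> \<alpha> p ?x) ?y = - t \<alpha>" using a.phi_skew[OF T] t' by simp
    show "g p (\<phi> \<alpha> p ?x) ?x = 0" "g p (\<phi> \<alpha> p ?y) ?y = 0" using a.g_phi_self T by auto
    then show "g p ?y (\<phi> \<alpha> p ?y) = 0" using g_sym[OF T(2) P(2)] by simp
    show "\<eta> \<alpha> p ?x = 0" "\<eta> \<alpha> p ?y = 0" using hor \<alpha> by (auto simp: horizontal_def)
    show "\<eta> \<alpha> p (bracket X Y p) = a \<alpha> - b \<alpha>"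
      using vf by (simp add: a_def b_def torsion_free a.eta_eq tangent_diff g_diff_right
          vf_tangent D_vf a.xi_tangent)
    show "\<eta> \<alpha> p (bar X Y p) = a \<alpha> + t \<alpha>"
      using eta_bar_horizontal[OF vf hor \<alpha>] t' by (simp add: a_def)
  qed
  have 1: "g p (bar X (bar Y Y) p) ?x = g p (D X (D Y Y) p) ?x + (\<Sum>\<alpha>\<in>I. 2 * (a \<alpha> + t \<alpha>) * t \<alpha>)"
  proof -
    have "g p (bar X (bar Y Y) p) ?x = g p (D X (bar Y Y) p) ?x"
      using vf hor fam by (simp add: g_bar bar_vf)
    also have "\<dots> = g p (D X (D Y Y) p) ?x + (\<Sum>\<alpha>\<in>I. 2 * (a \<alpha> + t \<alpha>) * t \<alpha>)"
      using vf hor by (simp add: g_D_bar fam a_def[symmetric]) (simp add: algebra_simps)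
    finally show ?thesis .
  qed
  have 2: "g p (bar Y (bar X Y) p) ?x = g p (D Y (D X Y) p) ?x
      + (\<Sum>\<alpha>\<in>I. (b \<alpha> - t \<alpha>) * t \<alpha> - t \<alpha> * t \<alpha>) + (\<Sum>\<alpha>\<in>I. (a \<alpha> + t \<alpha>) * t \<alpha>)"
    using vf hor by (simp add: g_bar bar_vf g_D_bar fam b_def[symmetric])
  have 3: "g p (bar (bracket X Y) Y p) ?x = g p (D (bracket X Y) Y p) ?x
      + (\<Sum>\<alpha>\<in>I. (a \<alpha> - b \<alpha>) * t \<alpha>)"
    using vf hor by (simp add: g_bar bracket_vf fam)
  have "g p (curvature bar X Y Y p) ?x = g p (bar X (bar Y Y) p) ?x
      - g p (bar Y (bar X Y) p) ?x - g p (bar (bracket X Y) Y p) ?x"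
    using vf by (simp add: curvature_def g_diff_left tangent_diff vf_tangent bar_vf bracket_vf)
  moreover have "g p (curvature D X Y Y p) ?x = g p (D X (D Y Y) p) ?x
      - g p (D Y (D X Y) p) ?x - g p (D (bracket X Y) Y p) ?x"
    using vf by (simp add: curvature_def g_diff_left tangent_diff vf_tangent D_vf bracket_vf)
  moreover have "(\<Sum>\<alpha>\<in>I. 2 * (a \<alpha> + t \<alpha>) * t \<alpha>) - ((\<Sum>\<alpha>\<in>I. (b \<alpha> - t \<alpha>) * t \<alpha> - t \<alpha> * t \<alpha>)
      + (\<Sum>\<alpha>\<in>I. (a \<alpha> + t \<alpha>) * t \<alpha>)) - (\<Sum>\<alpha>\<in>I. (a \<alpha> - b \<alpha>) * t \<alpha>) = 3 * (\<Sum>\<alpha>\<in>I. (t \<alpha>)\<^sup>2)"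
    unfolding sum.distrib[symmetric] sum_subtractf[symmetric] sum_distrib_left
    by (intro sum.cong refl) (simp add: algebra_simps power2_eq_square)
  moreover have "(\<Sum>\<alpha>\<in>I. (g p (\<phi> \<alpha> p ?x) ?y)\<^sup>2) = (\<Sum>\<alpha>\<in>I. (t \<alpha>)\<^sup>2)"
    by (intro sum.cong refl) (simp add: fam)
  ultimately show ?thesis using 1 2 3 by linarith
qed

end

section \<open>3-Sasakian manifolds\<close>

locale three_sasakian_manifold =
  fixes n :: nat and A :: "('m::{t2_space, second_countable_topology}, 'e::euclidean_space) chart set"
    and g D \<phi> \<eta> \<xi>
  assumes three_sasakian: "three_sasakian n A g D \<phi> \<eta> \<xi>"

sublocale three_sasakian_manifold \<subseteq> riemannian_manifold A g D
  using three_sasakian unfolding three_sasakian_def by unfold_locales auto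

abbreviation cyclic_triples :: "(nat \<times> nat \<times> nat) set" where
  "cyclic_triples \<equiv> {(1, 2, 3), (2, 3, 1), (3, 1, 2)}"

lemma cyclic_triples_indices:
  assumes "(\<beta>, \<gamma>, \<theta>) \<in> cyclic_triples"
  shows "\<beta> \<in> {1, 2, 3}" "\<gamma> \<in> {1, 2, 3}" "\<theta> \<in> {1, 2, 3}"
  using assms by auto

lemma cyclic_triples_rotate:
  assumes "(\<beta>, \<gamma>, \<theta>) \<in> cyclic_triples"
  shows "(\<gamma>, \<theta>, \<beta>) \<in> cyclic_triples" "(\<theta>, \<beta>, \<gamma>) \<in> cyclic_triples"
  using assms by auto

lemma distinct_pair_cases:
  fixes \<alpha> \<beta> :: nat
  assumes "\<alpha> \<in> {1, 2, 3}" "\<beta> \<in> {1, 2, 3}" "\<alpha> \<noteq> \<beta>"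
  obtains \<theta> where "(\<alpha>, \<beta>, \<theta>) \<in> cyclic_triples" | \<theta> where "(\<beta>, \<alpha>, \<theta>) \<in> cyclic_triples"
  using assms by auto

context three_sasakian_manifold
begin

lemma sasakian_structure: "\<alpha> \<in> {1, 2, 3} \<Longrightarrow> sasakian_manifold A g D (\<phi> \<alpha>) (\<eta> \<alpha>) (\<xi> \<alpha>)"
  using three_sasakian unfolding three_sasakian_def
  by (intro sasakian_manifold.intro riemannian_manifold_axioms sasakian_manifold_axioms.intro) blast

lemma quaternionic:
  assumes "(\<beta>, \<gamma>, \<theta>) \<in> cyclic_triples"
  shows "\<xi> \<theta> p = \<phi> \<beta> p (\<xi> \<gamma> p)" "\<xi> \<theta> p = - \<phi> \<gamma> p (\<xi> \<beta> p)"
    and "x \<in> T p \<Longrightarrow> \<phi> \<theta> p x = \<phi> \<beta> p (\<phi> \<gamma> p x) - tscale (\<eta> \<gamma> p x) (\<xi> \<beta> p)"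
    and "x \<in> T p \<Longrightarrow> \<eta> \<theta> p x = \<eta> \<beta> p (\<phi> \<gamma> p x)"
    and "x \<in> T p \<Longrightarrow> \<eta> \<theta> p x = - \<eta> \<gamma> p (\<phi> \<beta> p x)"
  using three_sasakian assms unfolding three_sasakian_def by blast+

text \<open>For \<open>\<alpha> \<noteq> \<beta>\<close> the Reeb field \<open>\<xi>\<^sub>\<beta>\<close> is, up to sign, \<open>\<phi>\<^sub>\<alpha>\<close> of the third one, and \<open>\<eta>\<^sub>\<alpha> \<circ> \<phi>\<^sub>\<alpha> = 0\<close>.\<close>

lemma xi_orthogonal:
  assumes "\<alpha> \<in> {1, 2, 3}" "\<beta> \<in> {1, 2, 3}" "\<alpha> \<noteq> \<beta>"
  shows "\<eta> \<alpha> p (\<xi> \<beta> p) = 0"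
proof -
  interpret a: sasakian_manifold A g D "\<phi> \<alpha>" "\<eta> \<alpha>" "\<xi> \<alpha>"
    by (rule sasakian_structure[OF assms(1)])
  have *: "\<eta> \<alpha> p (\<phi> \<alpha> p (\<xi> \<gamma> p)) = 0 \<and> \<eta> \<alpha> p (- \<phi> \<alpha> p (\<xi> \<gamma> p)) = 0"
    if \<gamma>: "\<gamma> \<in> {1, 2, 3}" for \<gamma>
  proof -
    have T: "\<xi> \<gamma> p \<in> T p" by (rule sasakian_manifold.xi_tangent[OF sasakian_structure[OF \<gamma>]])
    show ?thesis using a.eta_phi[OF T] a.eta_uminus[OF a.phi_tangent[OF T]] by simp
  qed
  show ?thesis
  proof (cases rule: distinct_pair_cases[OF assms])
    case (1 \<theta>)
    then show ?thesis
      using *[OF cyclic_triples_indices(3)[OF 1]]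
        quaternionic(2)[OF cyclic_triples_rotate(2)[OF 1], of p] by simp
  next
    case (2 \<theta>)
    then show ?thesis
      using *[OF cyclic_triples_indices(3)[OF 2]]
        quaternionic(1)[OF cyclic_triples_rotate(1)[OF 2], of p] by simp
  qed
qed

end

sublocale three_sasakian_manifold \<subseteq> sasakian_family A g D "{1, 2, 3}" \<phi> \<eta> \<xi>
  using sasakian_manifold.sasakian[OF sasakian_structure] xi_orthogonal by unfold_locales auto

context three_sasakian_manifold
begin

lemma contact_distribution_iff: "x \<in> contact_distribution A \<eta> p \<longleftrightarrow> horizontal p x"
  unfolding contact_distribution_def horizontal_def by simp

lemma phi_horizontal:
  assumes x: "horizontal p x" and \<alpha>: "\<alpha> \<in> {1, 2, 3}"
  shows "horizontal p (\<phi> \<alpha> p x)"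
  unfolding horizontal_def
proof (intro conjI ballI)
  interpret a: sasakian_manifold A g D "\<phi> \<alpha>" "\<eta> \<alpha>" "\<xi> \<alpha>" by (rule sasakian_structure[OF \<alpha>])
  have T: "x \<in> T p" by (rule horizontal_tangent[OF x])
  show "\<phi> \<alpha> p x \<in> T p" by (rule a.phi_tangent[OF T])
  fix \<beta> :: nat assume \<beta>: "\<beta> \<in> {1, 2, 3}"
  show "\<eta> \<beta> p (\<phi> \<alpha> p x) = 0"
  proof (cases "\<beta> = \<alpha>")
    case True
    then show ?thesis using a.eta_phi[OF T] by simp
  next
    case False
    show ?thesis
    proof (cases rule: distinct_pair_cases[OF \<beta> \<alpha> False])
      case (1 \<theta>)
      then show ?thesis
        using quaternionic(4)[OF 1 T] horizontal_eta[OF x cyclic_triples_indices(3)[OF 1]] by simp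
    next
      case (2 \<theta>)
      then show ?thesis
        using quaternionic(5)[OF 2 T] horizontal_eta[OF x cyclic_triples_indices(3)[OF 2]] by simp
    qed
  qed
qed

text \<open>On horizontal vectors \<open>\<phi>\<^sub>\<theta> = \<phi>\<^sub>\<beta> \<phi>\<^sub>\<gamma>\<close>, so \<open>g (\<phi>\<^sub>\<beta> x, \<phi>\<^sub>\<gamma> x) = - g (x, \<phi>\<^sub>\<theta> x)\<close>, which vanishes by
  skew-symmetry.\<close>

lemma phi_orthogonal:
  assumes x: "horizontal p x" and "\<alpha> \<in> {1, 2, 3}" "\<beta> \<in> {1, 2, 3}" "\<alpha> \<noteq> \<beta>"
  shows "g p (\<phi> \<alpha> p x) (\<phi> \<beta> p x) = 0"
proof -
  have T: "x \<in> T p" by (rule horizontal_tangent[OF x])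
  have *: "g p (\<phi> \<beta> p x) (\<phi> \<gamma> p x) = 0"
    if c: "(\<beta>, \<gamma>, \<theta>) \<in> cyclic_triples" for \<beta> \<gamma> \<theta>
  proof -
    interpret b: sasakian_manifold A g D "\<phi> \<beta>" "\<eta> \<beta>" "\<xi> \<beta>"
      by (rule sasakian_structure[OF cyclic_triples_indices(1)[OF c]])
    interpret c: sasakian_manifold A g D "\<phi> \<gamma>" "\<eta> \<gamma>" "\<xi> \<gamma>"
      by (rule sasakian_structure[OF cyclic_triples_indices(2)[OF c]])
    interpret t: sasakian_manifold A g D "\<phi> \<theta>" "\<eta> \<theta>" "\<xi> \<theta>"
      by (rule sasakian_structure[OF cyclic_triples_indices(3)[OF c]])
    have "\<eta> \<gamma> p x = 0" by (rule horizontal_eta[OF x cyclic_triples_indices(2)[OF c]])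
    then have "\<phi> \<theta> p x = \<phi> \<beta> p (\<phi> \<gamma> p x)"
      using quaternionic(3)[OF c T] by (simp add: tscale_simps)
    then have "g p (\<phi> \<beta> p x) (\<phi> \<gamma> p x) = - g p x (\<phi> \<theta> p x)"
      using b.phi_skew[OF T c.phi_tangent[OF T]] by simp
    also have "\<dots> = 0" using t.g_phi_self[OF T] g_sym[OF T t.phi_tangent[OF T]] by simp
    finally show ?thesis .
  qed
  have tan: "\<phi> \<alpha> p x \<in> T p" "\<phi> \<beta> p x \<in> T p"
    using sasakian_manifold.phi_tangent[OF sasakian_structure T] assms by auto
  show ?thesis
    by (cases rule: distinct_pair_cases[OF assms(2-4)]) (use * g_sym[OF tan] in metis)+
qed

lemma sum_g_phi_squared:
  assumes x: "horizontal p x" "g p x x = 1" and \<alpha>: "\<alpha> \<in> {1, 2, 3}"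
  shows "(\<Sum>\<beta>\<in>{1, 2, 3}. (g p (\<phi> \<beta> p x) (\<phi> \<alpha> p x))\<^sup>2) = 1"
proof -
  interpret a: sasakian_manifold A g D "\<phi> \<alpha>" "\<eta> \<alpha>" "\<xi> \<alpha>" by (rule sasakian_structure[OF \<alpha>])
  note T = horizontal_tangent[OF x(1)]
  have "g p (\<phi> \<alpha> p x) (\<phi> \<alpha> p x) = 1"
    using a.g_phi_phi[OF T T] horizontal_eta[OF x(1) \<alpha>] x(2) by simp
  then have "(\<Sum>\<beta>\<in>{1, 2, 3}. (g p (\<phi> \<beta> p x) (\<phi> \<alpha> p x))\<^sup>2) =
      (\<Sum>\<beta>\<in>{1, 2, 3}. if \<beta> = \<alpha> then 1 else 0)"
    using phi_orthogonal[OF x(1) _ \<alpha>] by (intro sum.cong refl) auto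
  also have "\<dots> = 1" using \<alpha> by auto
  finally show ?thesis .
qed

text \<open>By \<open>D_xi\<close> the two sums with covariant derivatives of the Reeb fields in the definition of the
  connection become the terms with \<open>\<phi>\<close>.\<close>

lemma bar_connection_eq:
  assumes "X \<in> VF" "Y \<in> VF"
  shows "bar_connection g D \<phi> \<eta> \<xi> X Y = bar X Y"
proof -
  have "bar_terms \<alpha> X Y = - fscale (app (\<eta> \<alpha>) X) (D Y (\<xi> \<alpha>)) - fscale (app (\<eta> \<alpha>) Y) (D X (\<xi> \<alpha>))
      + fscale (app2 (Omega g (\<phi> \<alpha>)) X Y) (\<xi> \<alpha>)" if "\<alpha> \<in> {1, 2, 3}" for \<alpha>
    using assms
    by (simp add: fun_eq_iff sasakian_manifold.bar_term_def[OF sasakian_structure[OF that]] fscale_def app_apply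
        sasakian_manifold.D_xi[OF sasakian_structure[OF that]] tscale_simps)
  then have "(\<Sum>\<alpha>\<in>{1, 2, 3}. bar_terms \<alpha> X Y) = (\<Sum>\<alpha>\<in>{1, 2, 3}.
      - fscale (app (\<eta> \<alpha>) X) (D Y (\<xi> \<alpha>)) - fscale (app (\<eta> \<alpha>) Y) (D X (\<xi> \<alpha>))
      + fscale (app2 (Omega g (\<phi> \<alpha>)) X Y) (\<xi> \<alpha>))"
    by (intro sum.cong refl)
  then show ?thesis
    unfolding bar_connection_def bar_def
    by (simp add: sum.distrib sum_subtractf sum_negf del: sum.insert)
qed

text \<open>For a unit vector \<open>x\<close> and \<open>y = \<phi>\<^sub>\<alpha> x\<close> the correction \<open>3 \<Sum>\<^sub>\<beta> g (\<phi>\<^sub>\<beta> x, y)\<^sup>2\<close> equals \<open>3\<close>, and the plane spanned by \<open>x\<close> and \<open>y\<close> has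
  unit area.\<close>

lemma holomorphic_curvature_eq:
  assumes "x \<in> contact_distribution A \<eta> p" "g p x x = 1" "\<alpha> \<in> {1, 2, 3}"
  shows "holomorphic_curvature_H A g D \<phi> \<eta> \<xi> \<alpha> p x = sectional_curvature A g D p x (\<phi> \<alpha> p x) + 3"
proof -
  interpret a: sasakian_manifold A g D "\<phi> \<alpha>" "\<eta> \<alpha>" "\<xi> \<alpha>" by (rule sasakian_structure[OF assms(3)])
  let ?y = "\<phi> \<alpha> p x"
  let ?X = "extension A p x" and ?Y = "extension A p ?y"
  have x: "horizontal p x" using assms(1) by (simp add: contact_distribution_iff)
  have y: "horizontal p ?y" by (rule phi_horizontal[OF x assms(3)])
  note T = horizontal_tangent[OF x] horizontal_tangent[OF y]
  note X = extension[OF T(1)] and Y = extension[OF T(2)]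
  have "curvature (bar_connection g D \<phi> \<eta> \<xi>) ?X ?Y ?Y = curvature bar ?X ?Y ?Y"
    unfolding curvature_def
    by (simp only: bar_connection_eq bar_vf bracket_vf X(1) Y(1))
  then have "holomorphic_curvature_H A g D \<phi> \<eta> \<xi> \<alpha> p x = g p (curvature bar ?X ?Y ?Y p) (?X p)"
    by (simp add: holomorphic_curvature_H_def curvature4_def X(2))
  also have "\<dots> = g p (curvature D ?X ?Y ?Y p) x + 3"
    using g_curvature_bar[OF X(1) Y(1), of p] x y sum_g_phi_squared[OF x assms(2,3)]
    by (simp only: X(2) Y(2) mult_1_right)
  also have "g p (curvature D ?X ?Y ?Y p) x = sectional_curvature A g D p x ?y"
  proof -
    have "g p x x * g p ?y ?y - (g p x ?y)\<^sup>2 = 1"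
      using assms(2) horizontal_eta[OF x assms(3)] a.g_phi_phi[OF T(1) T(1)]
        a.g_phi_self[OF T(1)] g_sym[OF T]
      by simp
    then show ?thesis by (simp add: sectional_curvature_def curvature4_def)
  qed
  finally show ?thesis .
qed

end

theorem theorem6:
  fixes A :: "('m::{t2_space, second_countable_topology}, 'e::euclidean_space) chart set"
    and g :: "'m \<Rightarrow> 'm tangent \<Rightarrow> 'm tangent \<Rightarrow> real"
    and nabla :: "'m connection"
    and \<phi> :: "nat \<Rightarrow> 'm \<Rightarrow> 'm tangent \<Rightarrow> 'm tangent"
    and \<eta> :: "nat \<Rightarrow> 'm \<Rightarrow> 'm tangent \<Rightarrow> real"
    and \<xi> :: "nat \<Rightarrow> 'm vfield"
    and n \<alpha> :: nat and k :: real and p :: 'm and x :: "'m tangent"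
  assumes "three_sasakian n A g nabla \<phi> \<eta> \<xi>"
    and "\<alpha> \<in> {1, 2, 3}"
    and "x \<in> contact_distribution A \<eta> p"
    and "g p x x = 1"
  shows "holomorphic_curvature_H A g nabla \<phi> \<eta> \<xi> \<alpha> p x = k \<longleftrightarrow>
    sectional_curvature A g nabla p x (\<phi> \<alpha> p x) = k - 3"
proof -
  interpret three_sasakian_manifold n A g nabla \<phi> \<eta> \<xi>
    by (rule three_sasakian_manifold.intro[OF assms(1)])
  show ?thesis using holomorphic_curvature_eq[OF assms(3,4,2)] by auto
qed

end
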